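(* Let $p\ge1$, $m=2p$, $N\ge0$, and let $\beta(0),\dots,\beta(N)$ be $p\times m$ matrices with $\beta(k)J\beta(k)^*=I_p$. Put $C_k=2K^*\beta(k)^*\beta(k)K-j$ ($0\le k\le N$), let $W_k(\lambda)$ be the solution of $W_{k+1}(\lambda)-W_k(\lambda)=-\frac{i}{\lambda}jC_kW_k(\lambda)$ with $W_0=I_m$, and let $\mathcal W(\lambda)=\{\mathcal W_{ij}(\lambda)\}_{i,j=1}^2=KW_{N+1}(\bar\lambda)^*$ (blocks of size $p\times p$). Let $R,Q$ be $p\times p$ matrix functions analytic in a neighbourhood of $\lambda=-i$ with $\det\big(\mathcal W_{11}(-i)R(-i)+\mathcal W_{12}(-i)Q(-i)\big)\neq0$, and put $$\varphi(\lambda)=i\big(\mathcal W_{21}(\lambda)R(\lambda)+\mathcal W_{22}(\lambda)Q(\lambda)\big)\big(\mathcal W_{11}(\lambda)R(\lambda)+\mathcal W_{12}(\lambda)Q(\lambda)\big)^{-1}.$$ Then: $C_k=C_k^*$, $C_kjC_k=j$ and $C_k>0$ for $0\le k\le N$; $\det(\beta(k)J\beta(k+1)^* )\neq0$ for $0\le k\le N-1$; and the matrices $C_0,\dots,C_N$ are uniquely determined by the first $N+1$ Taylor coefficients $\alpha_0,\dots,\alpha_N$ at $z=0$ of $i\varphi\big(i\frac{z+1}{z-1}\big)$, as follows. Let $\Phi_1$ be the $(N+1)p\times p$ block column with all blocks $I_p$, $\Phi_2$ the block column with blocks $\alpha_0,\ \alpha_0+\alpha_1,\ \dots,\ \alpha_0+\alpha_1+\dots+\alpha_N$,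 $\Pi=[\Phi_1\ \ \Phi_2]$, and $A=\{a_{j-k}\}_{k,j=0}^N$ the $(N+1)p\times(N+1)p$ block matrix with $a_r=0$ for $r>0$, $a_0=\frac i2I_p$, $a_r=iI_p$ for $r<0$. Then the matrix identity $AS-SA^*=i\Pi J\Pi^*$ has a unique solution $S$, this $S$ is positive definite, and $$\Pi^*S^{-1}\Pi=B^*B=\sum_{k=0}^N\beta(k)^*\beta(k),\qquad B=\begin{bmatrix}\beta(0)\\ \vdots\\ \beta(N)\end{bmatrix}.$$
   Context: $j=\mathrm{diag}(I_p,-I_p)$, $J=\begin{bmatrix}0&I_p\\ I_p&0\end{bmatrix}$, $K=\frac1{\sqrt2}\begin{bmatrix}I_p&-I_p\\ I_p&I_p\end{bmatrix}$ (so $K^*=K^{-1}$, $KjK^*=J$); $I_p$ is the $p\times p$ identity matrix. *)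

theory Defs
  imports "HOL-Analysis.Analysis" "Jordan_Normal_Form.Schur_Decomposition"
    "Jordan_Normal_Form.Gauss_Jordan_Elimination"
begin

abbreviation adj :: "complex mat \<Rightarrow> complex mat" where "adj M \<equiv> mat_adjoint M"

definition minv :: "complex mat \<Rightarrow> complex mat" where
  "minv M = (case mat_inverse M of Some B \<Rightarrow> B | None \<Rightarrow> 0\<^sub>m (dim_col M) (dim_row M))"

definition jmat :: "nat \<Rightarrow> complex mat" where
  "jmat p = four_block_mat (1\<^sub>m p) (0\<^sub>m p p) (0\<^sub>m p p) (- 1\<^sub>m p)"

definition Jmat :: "nat \<Rightarrow> complex mat" where
  "Jmat p = four_block_mat (0\<^sub>m p p) (1\<^sub>m p) (1\<^sub>m p) (0\<^sub>m p p)"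

definition Kmat :: "nat \<Rightarrow> complex mat" where
  "Kmat p = (1 / complex_of_real (sqrt 2)) \<cdot>\<^sub>m four_block_mat (1\<^sub>m p) (- 1\<^sub>m p) (1\<^sub>m p) (1\<^sub>m p)"

definition pos_def :: "nat \<Rightarrow> complex mat \<Rightarrow> bool" where
  "pos_def n M \<longleftrightarrow> M \<in> carrier_mat n n \<and> adj M = M \<and>
     (\<forall>v \<in> carrier_vec n. v \<noteq> 0\<^sub>v n \<longrightarrow>
        0 < Re (\<Sum>i<n. cnj (v $ i) * (M *\<^sub>v v) $ i))"

definition Cmat :: "nat \<Rightarrow> (nat \<Rightarrow> complex mat) \<Rightarrow> nat \<Rightarrow> complex mat" where
  "Cmat p \<beta> k = 2 \<cdot>\<^sub>m (adj (Kmat p) * adj (\<beta> k) * \<beta> k * Kmat p) - jmat p"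

fun Wmat :: "nat \<Rightarrow> (nat \<Rightarrow> complex mat) \<Rightarrow> nat \<Rightarrow> complex \<Rightarrow> complex mat" where
  "Wmat p \<beta> 0 z = 1\<^sub>m (2 * p)"
| "Wmat p \<beta> (Suc k) z = Wmat p \<beta> k z - (\<i> / z) \<cdot>\<^sub>m (jmat p * Cmat p \<beta> k * Wmat p \<beta> k z)"

definition calW :: "nat \<Rightarrow> nat \<Rightarrow> (nat \<Rightarrow> complex mat) \<Rightarrow> complex \<Rightarrow> complex mat" where
  "calW p N \<beta> z = Kmat p * adj (Wmat p \<beta> (Suc N) (cnj z))"

definition W11 where "W11 p N \<beta> z = fst (split_block (calW p N \<beta> z) p p)"
definition W12 where "W12 p N \<beta> z = fst (snd (split_block (calW p N \<beta> z) p p))"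
definition W21 where "W21 p N \<beta> z = fst (snd (snd (split_block (calW p N \<beta> z) p p)))"
definition W22 where "W22 p N \<beta> z = snd (snd (snd (split_block (calW p N \<beta> z) p p)))"

definition phi :: "nat \<Rightarrow> nat \<Rightarrow> (nat \<Rightarrow> complex mat) \<Rightarrow> (complex \<Rightarrow> complex mat)
    \<Rightarrow> (complex \<Rightarrow> complex mat) \<Rightarrow> complex \<Rightarrow> complex mat" where
  "phi p N \<beta> R Q z = \<i> \<cdot>\<^sub>m ((W21 p N \<beta> z * R z + W22 p N \<beta> z * Q z)
       * minv (W11 p N \<beta> z * R z + W12 p N \<beta> z * Q z))"

definition taylor_coeff :: "(complex \<Rightarrow> complex) \<Rightarrow> nat \<Rightarrow> complex" where
  "taylor_coeff f r = (deriv ^^ r) f 0 / fact r"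

definition alpha :: "nat \<Rightarrow> nat \<Rightarrow> (nat \<Rightarrow> complex mat) \<Rightarrow> (complex \<Rightarrow> complex mat)
    \<Rightarrow> (complex \<Rightarrow> complex mat) \<Rightarrow> nat \<Rightarrow> complex mat" where
  "alpha p N \<beta> R Q r = mat p p (\<lambda>(a, b).
      taylor_coeff (\<lambda>z. (\<i> \<cdot>\<^sub>m phi p N \<beta> R Q (\<i> * (z + 1) / (z - 1))) $$ (a, b)) r)"

definition mat_analytic_near :: "nat \<Rightarrow> (complex \<Rightarrow> complex mat) \<Rightarrow> complex \<Rightarrow> bool" where
  "mat_analytic_near p F z0 \<longleftrightarrow> (\<forall>z. F z \<in> carrier_mat p p) \<and>
     (\<exists>e>0. \<forall>a<p. \<forall>b<p. (\<lambda>z. F z $$ (a, b)) analytic_on ball z0 e)"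

definition admissible :: "nat \<Rightarrow> nat \<Rightarrow> (nat \<Rightarrow> complex mat) \<Rightarrow> (complex \<Rightarrow> complex mat)
    \<Rightarrow> (complex \<Rightarrow> complex mat) \<Rightarrow> bool" where
  "admissible p N \<beta> R Q \<longleftrightarrow>
     (\<forall>k\<le>N. \<beta> k \<in> carrier_mat p (2 * p) \<and> \<beta> k * Jmat p * adj (\<beta> k) = 1\<^sub>m p) \<and>
     mat_analytic_near p R (- \<i>) \<and> mat_analytic_near p Q (- \<i>) \<and>
     det (W11 p N \<beta> (- \<i>) * R (- \<i>) + W12 p N \<beta> (- \<i>) * Q (- \<i>)) \<noteq> 0"

definition Phi1 :: "nat \<Rightarrow> nat \<Rightarrow> complex mat" where
  "Phi1 p N = mat ((Suc N) * p) p (\<lambda>(r, c). if r mod p = c then 1 else 0)"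

definition Phi2 :: "nat \<Rightarrow> nat \<Rightarrow> (nat \<Rightarrow> complex mat) \<Rightarrow> complex mat" where
  "Phi2 p N \<alpha> = mat ((Suc N) * p) p (\<lambda>(r, c). \<Sum>l\<le>r div p. \<alpha> l $$ (r mod p, c))"

definition PiMat :: "nat \<Rightarrow> nat \<Rightarrow> (nat \<Rightarrow> complex mat) \<Rightarrow> complex mat" where
  "PiMat p N \<alpha> = mat ((Suc N) * p) (2 * p)
     (\<lambda>(r, c). if c < p then Phi1 p N $$ (r, c) else Phi2 p N \<alpha> $$ (r, c - p))"

definition Amat :: "nat \<Rightarrow> nat \<Rightarrow> complex mat" where
  "Amat p N = mat ((Suc N) * p) ((Suc N) * p) (\<lambda>(r, c).
     (let k = r div p; j = c div p in
      if r mod p \<noteq> c mod p then 0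
      else if j > k then 0 else if j = k then \<i> / 2 else \<i>))"

definition Bmat :: "nat \<Rightarrow> nat \<Rightarrow> (nat \<Rightarrow> complex mat) \<Rightarrow> complex mat" where
  "Bmat p N \<beta> = mat ((Suc N) * p) (2 * p) (\<lambda>(r, c). \<beta> (r div p) $$ (r mod p, c))"

definition mat_sum :: "nat \<Rightarrow> (nat \<Rightarrow> complex mat) \<Rightarrow> nat \<Rightarrow> complex mat" where
  "mat_sum n M N = foldr (+) (map M [0..<Suc N]) (0\<^sub>m n n)"

end

theory Submission
  imports Defs "HOL-Complex_Analysis.Complex_Analysis"
begin

text \<open>
  Put \<open>P\<^sub>k = \<beta>(k)\<^sup>* \<beta>(k) J\<close>, a projection. Under \<open>\<lambda> = \<i> (z + 1) / (z - 1)\<close> the matrix \<open>\<W>\<close> becomes,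
  up to a scalar factor, \<open>F\<^sub>0(z) \<cdots> F\<^sub>N(z) K\<close> with \<open>F\<^sub>k(z) = 1 + (z - 1) P\<^sub>k\<close>, so the column with blocks
  \<open>1\<close> and \<open>- G\<close>, \<open>G = \<i> \<phi>\<close>, factors as \<open>F\<^sub>0 \<cdots> F\<^sub>N Y\<close> with \<open>Y\<close> analytic at \<open>0\<close>. Its left annihilator
  \<open>g\<^sub>0 = [G 1]\<close> is therefore divisible step by step: \<open>g\<^sub>k F\<^sub>k = z g\<^sub>k\<^sub>+\<^sub>1\<close>. The Taylor coefficients of
  \<open>t\<^sub>k = z\<^sup>k g\<^sub>k \<beta>(k)\<^sup>*\<close> are the block columns of an invertible block lower triangular matrix \<open>T\<close> with
  \<open>T B = \<Pi>\<close> and \<open>A T = T A\<^sub>B\<close>, where \<open>A\<^sub>B\<close> is the lower triangular matrix with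
  \<open>A\<^sub>B - A\<^sub>B\<^sup>* = \<i> B J B\<^sup>*\<close>. Hence \<open>S = T T\<^sup>*\<close>, which gives positivity and \<open>\<Pi>\<^sup>* S\<^sup>-\<^sup>1 \<Pi> = B\<^sup>* B\<close>.
  Truncating the sequence at every \<open>M \<le> N\<close> recovers each \<open>\<beta>(k)\<^sup>* \<beta>(k)\<close> as a difference.
\<close>

unbundle no vec_syntax
no_notation fps_nth (infixl "$" 75)

text \<open>Divisibility by z is a dimension count. The value at 0 of the part of the column left
  after k factors has rank p: it is \<open>(1 - P\<^sub>k)\<close> times the next one, so the rank
  cannot drop along the chain. Its range lies in the kernel of \<open>\<beta>(k) J\<close>, which
  has dimension p too and equals the range of \<open>1 - P\<^sub>k\<close>. What annihilates the
  column at 0 therefore annihilates \<open>1 - P\<^sub>k = F\<^sub>k(0)\<close>. The partial sums in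
  \<Pi> and the constant blocks \<i> below the diagonal of A have one source, division by 1 - z:
  from \<open>(1 - z) P\<^sub>k = 1 - F\<^sub>k\<close> the products
  \<open>t\<^sub>k \<beta>(k) J\<close>, multiplied by 1 - z, telescope. The diagonal \<i>/2 is the
  half of \<i> that remains when \<i> is split as a - cnj a, matching the identity blocks on the
  diagonal of \<open>B J B\<^sup>*\<close>. Analysis enters only in expanding the column in a power
  series at z = 0; everything afterwards is algebra over formal power series and holds for every
  truncation of the chain. Positivity of the \<open>C\<^sub>k\<close> is a separate matter, a
  statement about the indefinite form j alone.\<close>

lemma dim_adj [simp]: "dim_row (adj A) = dim_col A" "dim_col (adj A) = dim_row A"
  by (simp_all add: mat_adjoint_def)

lemma index_adj [simp]:
  "i < dim_col A \<Longrightarrow> j < dim_row A \<Longrightarrow> adj A $$ (i, j) = cnj (A $$ (j, i))"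
  by (simp add: mat_adjoint_def mat_of_rows_index)

lemma carrier_adj [simp]: "A \<in> carrier_mat n m \<Longrightarrow> adj A \<in> carrier_mat m n"
  by auto

lemma adj_adj [simp]: "adj (adj A) = A"
  by (rule eq_matI) auto

lemma adj_one [simp]: "adj (1\<^sub>m n) = 1\<^sub>m n"
  by (rule eq_matI) auto

lemma adj_mult: "dim_col A = dim_row B \<Longrightarrow> adj (A * B) = adj B * adj A"
  by (rule eq_matI) (auto simp: scalar_prod_def mult.commute)

lemma adj_minus:
  "dim_row A = dim_row B \<Longrightarrow> dim_col A = dim_col B \<Longrightarrow> adj (A - B) = adj A - adj B"
  by (rule eq_matI) auto

lemma adj_add:
  "dim_row A = dim_row B \<Longrightarrow> dim_col A = dim_col B \<Longrightarrow> adj (A + B) = adj A + adj B"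
  by (rule eq_matI) auto

lemma adj_smult: "adj (c \<cdot>\<^sub>m A) = cnj c \<cdot>\<^sub>m adj A"
  by (rule eq_matI) auto

text \<open>The ring laws with dimension equations instead of carrier sets as side conditions, so that
  the simplifier can discharge them.\<close>

lemma mat_mult_assoc:
  fixes A :: "'a::semiring_0 mat"
  shows "dim_col A = dim_row B \<Longrightarrow> dim_col B = dim_row C \<Longrightarrow> A * B * C = A * (B * C)"
  by (rule assoc_mult_mat[of _ "dim_row A" "dim_row B" _ "dim_row C" _ "dim_col C"]) auto

lemma mat_add_mult:
  fixes A :: "'a::semiring_0 mat"
  shows "dim_row A = dim_row B \<Longrightarrow> dim_col A = dim_col B \<Longrightarrow> dim_col A = dim_row C \<Longrightarrow>
    (A + B) * C = A * C + B * C"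
  by (rule add_mult_distrib_mat[of _ "dim_row A" "dim_row C" _ _ "dim_col C"]) auto

lemma mat_mult_add:
  fixes A :: "'a::semiring_0 mat"
  shows "dim_row B = dim_row C \<Longrightarrow> dim_col B = dim_col C \<Longrightarrow> dim_col A = dim_row B \<Longrightarrow>
    A * (B + C) = A * B + A * C"
  by (rule mult_add_distrib_mat[of _ "dim_row A" "dim_row B" _ "dim_col B"]) auto

lemma mat_minus_mult:
  fixes A :: "'a::ring mat"
  shows "dim_row A = dim_row B \<Longrightarrow> dim_col A = dim_col B \<Longrightarrow> dim_col A = dim_row C \<Longrightarrow>
    (A - B) * C = A * C - B * C"
  by (rule minus_mult_distrib_mat[of _ "dim_row A" "dim_row C" _ _ "dim_col C"]) auto

lemma mat_mult_minus:
  fixes A :: "'a::ring mat"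
  shows "dim_row B = dim_row C \<Longrightarrow> dim_col B = dim_col C \<Longrightarrow> dim_col A = dim_row B \<Longrightarrow>
    A * (B - C) = A * B - A * C"
  by (rule mult_minus_distrib_mat[of _ "dim_row A" "dim_row B" _ "dim_col B"]) auto

lemma mat_smult_mult:
  fixes A :: "'a::comm_semiring_0 mat"
  shows "dim_col A = dim_row B \<Longrightarrow> (c \<cdot>\<^sub>m A) * B = c \<cdot>\<^sub>m (A * B)"
  by (rule eq_matI) auto

lemma mat_mult_smult:
  fixes A :: "'a::comm_semiring_0 mat"
  shows "dim_col A = dim_row B \<Longrightarrow> A * (c \<cdot>\<^sub>m B) = c \<cdot>\<^sub>m (A * B)"
  by (rule eq_matI) auto

lemma mat_one_mult:
  fixes A :: "'a::semiring_1 mat"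
  shows "dim_row A = n \<Longrightarrow> 1\<^sub>m n * A = A" "dim_col A = n \<Longrightarrow> A * 1\<^sub>m n = A"
  by auto

lemmas mat_ring_simps = mat_mult_assoc mat_add_mult mat_mult_add mat_minus_mult mat_mult_minus
  mat_smult_mult mat_mult_smult mat_one_mult adj_mult adj_minus adj_add adj_smult

lemma minv_inverse:
  assumes A: "A \<in> carrier_mat n n" and d: "det A \<noteq> 0"
  shows "A * minv A = 1\<^sub>m n" "minv A * A = 1\<^sub>m n" "minv A \<in> carrier_mat n n"
proof -
  have "A \<in> Units (ring_mat TYPE(complex) n ())"
    by (rule det_non_zero_imp_unit[OF A d])
  then obtain B where "mat_inverse A = Some B"
    using mat_inverse(1)[OF A, of "()"] by (cases "mat_inverse A") auto
  moreover from this have "A * B = 1\<^sub>m n \<and> B * A = 1\<^sub>m n \<and> B \<in> carrier_mat n n"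
    by (rule mat_inverse(2)[OF A])
  ultimately show "A * minv A = 1\<^sub>m n" "minv A * A = 1\<^sub>m n" "minv A \<in> carrier_mat n n"
    by (simp_all add: minv_def)
qed

lemma minv_unique:
  assumes A: "A \<in> carrier_mat n n" and B: "B \<in> carrier_mat n n" and AB: "A * B = 1\<^sub>m n"
  shows "minv A = B"
proof -
  have "det A * det B = 1"
    using det_mult[OF A B] AB by simp
  hence d: "det A \<noteq> 0" by auto
  note I = minv_inverse[OF A d]
  have "minv A * (A * B) = (minv A * A) * B"
    using A B I(3) by (simp add: mat_mult_assoc)
  thus ?thesis using I B by (simp add: AB)
qed

section \<open>Hermitian forms and the matrices j, J, K\<close>

definition ip :: "complex vec \<Rightarrow> complex vec \<Rightarrow> complex" where
  "ip u v = (\<Sum>i<dim_vec v. cnj (u $ i) * v $ i)"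

lemma ip_add_left: "dim_vec u = dim_vec w \<Longrightarrow> dim_vec u' = dim_vec w \<Longrightarrow> ip (u + u') w = ip u w + ip u' w"
  by (simp add: ip_def algebra_simps sum.distrib)

lemma ip_add_right: "dim_vec u = dim_vec w \<Longrightarrow> dim_vec u' = dim_vec w \<Longrightarrow> ip w (u + u') = ip w u + ip w u'"
  by (simp add: ip_def algebra_simps sum.distrib)

lemma ip_adj:
  assumes "dim_vec u = dim_row A" "dim_vec v = dim_col A"
  shows "ip u (A *\<^sub>v v) = ip (adj A *\<^sub>v u) v"
proof -
  have "ip u (A *\<^sub>v v) = (\<Sum>i<dim_row A. \<Sum>j<dim_col A. cnj (u $ i) * (A $$ (i, j) * v $ j))"
    using assms by (simp add: ip_def scalar_prod_def sum_distrib_left atLeast0LessThan)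
  also have "\<dots> = (\<Sum>j<dim_col A. \<Sum>i<dim_row A. cnj (u $ i) * (A $$ (i, j) * v $ j))"
    by (rule sum.swap)
  also have "\<dots> = ip (adj A *\<^sub>v u) v"
    using assms by (simp add: ip_def scalar_prod_def sum_distrib_left sum_distrib_right atLeast0LessThan mult_ac)
  finally show ?thesis .
qed

lemma Re_ip_self: "Re (ip v v) = (\<Sum>i<dim_vec v. (cmod (v $ i))\<^sup>2)"
  unfolding ip_def Re_sum by (intro sum.cong refl) (simp add: cmod_power2 flip: power2_eq_square)

lemma Re_ip_self_nonneg: "0 \<le> Re (ip v v)"
  unfolding Re_ip_self by (intro sum_nonneg) auto

lemma Re_ip_self_zeroD:
  assumes "Re (ip v v) \<le> 0" and n: "dim_vec v = n"
  shows "v = 0\<^sub>v n"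
proof -
  have "(\<Sum>i<n. (cmod (v $ i))\<^sup>2) = 0"
    using assms Re_ip_self_nonneg[of v] by (simp add: Re_ip_self)
  hence "\<forall>i<n. v $ i = 0"
    by (subst (asm) sum_nonneg_eq_0_iff) auto
  thus ?thesis using n by (intro eq_vecI) auto
qed

lemma pos_def_iff_ip:
  "pos_def n M \<longleftrightarrow> M \<in> carrier_mat n n \<and> adj M = M \<and>
     (\<forall>v \<in> carrier_vec n. v \<noteq> 0\<^sub>v n \<longrightarrow> 0 < Re (ip v (M *\<^sub>v v)))"
  by (auto simp: pos_def_def ip_def)

lemma jmat_carrier [simp]: "jmat p \<in> carrier_mat (2 * p) (2 * p)"
  and jmat_dim [simp]: "dim_row (jmat p) = 2 * p" "dim_col (jmat p) = 2 * p"
  by (auto simp: jmat_def)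

lemma Jmat_carrier [simp]: "Jmat p \<in> carrier_mat (2 * p) (2 * p)"
  and Jmat_dim [simp]: "dim_row (Jmat p) = 2 * p" "dim_col (Jmat p) = 2 * p"
  by (auto simp: Jmat_def)

lemma Kmat_carrier [simp]: "Kmat p \<in> carrier_mat (2 * p) (2 * p)"
  and Kmat_dim [simp]: "dim_row (Kmat p) = 2 * p" "dim_col (Kmat p) = 2 * p"
  by (auto simp: Kmat_def)

lemma jmat_index:
  "i < 2 * p \<Longrightarrow> k < 2 * p \<Longrightarrow> jmat p $$ (i, k) = (if i = k then if i < p then 1 else - 1 else 0)"
  by (auto simp: jmat_def)

lemma adj_jmat [simp]: "adj (jmat p) = jmat p"
  by (rule eq_matI) (auto simp: jmat_index)

lemma adj_Jmat [simp]: "adj (Jmat p) = Jmat p"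
  by (rule eq_matI) (auto simp: Jmat_def)

lemma adj_Kmat:
  "adj (Kmat p) = (1 / complex_of_real (sqrt 2)) \<cdot>\<^sub>m
     four_block_mat (1\<^sub>m p) (1\<^sub>m p) (- 1\<^sub>m p) (1\<^sub>m p)"
  by (rule eq_matI) (auto simp: Kmat_def)

lemma sqrt2_square: "complex_of_real (sqrt 2) * complex_of_real (sqrt 2) = 2"
  by (metis of_real_mult of_real_numeral real_sqrt_mult_self abs_numeral)

lemma Kmat_adj [simp]: "Kmat p * adj (Kmat p) = 1\<^sub>m (2 * p)"
proof -
  have *: "Kmat p * adj (Kmat p) = (1 / 2) \<cdot>\<^sub>m
     (four_block_mat (1\<^sub>m p) (- 1\<^sub>m p) (1\<^sub>m p) (1\<^sub>m p) *
      four_block_mat (1\<^sub>m p) (1\<^sub>m p) (- 1\<^sub>m p) (1\<^sub>m p))"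
    unfolding adj_Kmat unfolding Kmat_def
    by (rule eq_matI) (auto simp: mat_smult_mult mat_mult_smult sqrt2_square)
  show ?thesis
    unfolding * by (subst mult_four_block_mat[of _ p p _ p _ p _ _ p _ p]) (auto intro!: eq_matI)
qed

lemma Jmat_square [simp]: "Jmat p * Jmat p = 1\<^sub>m (2 * p)"
  unfolding Jmat_def
  by (subst mult_four_block_mat[of _ p p _ p _ p _ _ p _ p]) (auto intro!: eq_matI)

lemma jmat_square [simp]: "jmat p * jmat p = 1\<^sub>m (2 * p)"
  unfolding jmat_def
  by (subst mult_four_block_mat[of _ p p _ p _ p _ _ p _ p]) (auto intro!: eq_matI)

lemma Kmat_jmat: "Kmat p * jmat p = Jmat p * Kmat p"
proof -
  have *: "four_block_mat (1\<^sub>m p) (- 1\<^sub>m p) (1\<^sub>m p) (1\<^sub>m p) * jmat p =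
    Jmat p * four_block_mat (1\<^sub>m p) (- 1\<^sub>m p) (1\<^sub>m p) (1\<^sub>m p :: complex mat)"
    unfolding Jmat_def jmat_def
    by (subst mult_four_block_mat[of _ p p _ p _ p _ _ p _ p]; simp?)+ (auto intro!: eq_matI)
  show ?thesis
    unfolding Kmat_def by (simp add: mat_smult_mult mat_mult_smult *)
qed

lemma Kmat_jmat_adj: "Kmat p * (jmat p * adj (Kmat p)) = Jmat p"
proof -
  have "Kmat p * (jmat p * adj (Kmat p)) = Kmat p * jmat p * adj (Kmat p)"
    by (simp add: mat_mult_assoc)
  also have "\<dots> = Jmat p * (Kmat p * adj (Kmat p))"
    unfolding Kmat_jmat by (simp add: mat_mult_assoc del: Kmat_adj)
  finally show ?thesis by (simp add: mat_one_mult)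
qed

section \<open>Positivity of the matrices \<open>C\<^sub>k\<close>\<close>

lemma mat_vec_assoc:
  "dim_col A = dim_row B \<Longrightarrow> dim_col B = dim_vec v \<Longrightarrow>
    (A * B) *\<^sub>v v = A *\<^sub>v (B *\<^sub>v (v :: complex vec))"
  by (rule assoc_mult_mat_vec[of _ "dim_row A" "dim_row B" _ "dim_vec v"]) auto

lemma mat_vec_add:
  "dim_col A = dim_vec u \<Longrightarrow> dim_vec u = dim_vec v \<Longrightarrow>
    A *\<^sub>v (u + v) = A *\<^sub>v u + A *\<^sub>v (v :: complex vec)"
  by (rule mult_add_distrib_mat_vec[of _ "dim_row A" "dim_col A"]) (auto intro: carrier_vecI)

lemma ip_jmat_lower_half:
  assumes u: "dim_vec u = 2 * p" and z: "\<And>i. i < p \<Longrightarrow> u $ i = 0"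
  shows "ip u (jmat p *\<^sub>v u) = - ip u u"
proof -
  have "(jmat p *\<^sub>v u) $ i = - (u $ i)" if i: "i < 2 * p" for i
  proof -
    have "(jmat p *\<^sub>v u) $ i = (\<Sum>k<2 * p. (if i = k then if i < p then 1 else - 1 else 0) * u $ k)"
      using i u by (simp add: scalar_prod_def atLeast0LessThan jmat_index)
    also have "\<dots> = (\<Sum>k<2 * p. if k = i then (if i < p then 1 else - 1) * u $ k else 0)"
      by (intro sum.cong) auto
    also have "\<dots> = - (u $ i)"
      using i z[of i] by simp
    finally show ?thesis .
  qed
  thus ?thesis
    using u by (simp add: ip_def sum_negf)
qed

text \<open>Extending the positive subspace spanned by the columns of \<open>adj \<gamma>\<close> by the \<open>j\<close>-orthogonal
  vector \<open>y\<close>, one finds a vector whose upper half vanishes; on it the form \<open>j\<close> is negative.\<close>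

lemma j_orthogonal_complement_negative:
  assumes \<gamma>: "\<gamma> \<in> carrier_mat p (2 * p)" and \<gamma>j: "\<gamma> * jmat p * adj \<gamma> = 1\<^sub>m p"
    and y: "y \<in> carrier_vec (2 * p)" and \<gamma>y: "\<gamma> *\<^sub>v y = 0\<^sub>v p"
  shows "Re (ip y (jmat p *\<^sub>v y)) \<le> 0" and "Re (ip y (jmat p *\<^sub>v y)) = 0 \<Longrightarrow> y = 0\<^sub>v (2 * p)"
proof -
  have dims [simp]: "dim_row \<gamma> = p" "dim_col \<gamma> = 2 * p" "dim_vec y = 2 * p"
    using \<gamma> y by auto
  define G where "G = mat p p (\<lambda>(i, k). adj \<gamma> $$ (i, k))"
  have G: "G \<in> carrier_mat p p" by (simp add: G_def)
  have Gv: "(G *\<^sub>v v) $ i = (adj \<gamma> *\<^sub>v v) $ i" if "dim_vec v = p" "i < p" for v i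
    using that by (auto simp: G_def scalar_prod_def)
  have form: "ip (adj \<gamma> *\<^sub>v v) (jmat p *\<^sub>v (adj \<gamma> *\<^sub>v v)) = ip v v" if v: "dim_vec v = p" for v
  proof -
    have "ip (adj \<gamma> *\<^sub>v v) (jmat p *\<^sub>v (adj \<gamma> *\<^sub>v v)) = ip v (\<gamma> *\<^sub>v (jmat p *\<^sub>v (adj \<gamma> *\<^sub>v v)))"
      using v by (subst ip_adj[of v \<gamma>]) auto
    also have "\<gamma> *\<^sub>v (jmat p *\<^sub>v (adj \<gamma> *\<^sub>v v)) = (\<gamma> * jmat p * adj \<gamma>) *\<^sub>v v"
      using v by (simp add: mat_vec_assoc)
    finally show ?thesis by (simp add: \<gamma>j one_mult_mat_vec[OF carrier_vecI[OF v]])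
  qed
  \<comment> \<open>\<open>G\<close> is the upper half of \<open>adj \<gamma>\<close>. If v is in
    its kernel, the image of v under \<open>adj \<gamma>\<close> has zero upper half, so the form j
    takes there a value that equals \<open>ip v v\<close> and is also at most 0.\<close>
  have "det G \<noteq> 0"
  proof
    assume "det G = 0"
    then obtain v where v: "v \<in> carrier_vec p" "v \<noteq> 0\<^sub>v p" "G *\<^sub>v v = 0\<^sub>v p"
      using det_0_iff_vec_prod_zero_field[OF G] by auto
    have "(adj \<gamma> *\<^sub>v v) $ i = 0" if "i < p" for i
      using Gv[of v i] v that by simp
    hence "ip v v = - ip (adj \<gamma> *\<^sub>v v) (adj \<gamma> *\<^sub>v v)"
      using form[of v] v by (simp add: ip_jmat_lower_half)
    hence "Re (ip v v) \<le> 0"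
      using Re_ip_self_nonneg[of "adj \<gamma> *\<^sub>v v"] by simp
    thus False
      using Re_ip_self_zeroD[of v p] v by simp
  qed
  note I = minv_inverse[OF G this]
  \<comment> \<open>Chosen so that the upper half of the vector \<open>x\<close> below cancels that
    of \<open>y\<close>.\<close>
  define a where "a = minv G *\<^sub>v (- vec_first y p)"
  have a [simp]: "dim_vec a = p"
    using I(3) by (simp add: a_def)
  have "G *\<^sub>v a = (G * minv G) *\<^sub>v (- vec_first y p)"
    unfolding a_def using I(3) G by (intro assoc_mult_mat_vec[symmetric]) auto
  hence Ga: "G *\<^sub>v a = - vec_first y p"
    by (simp add: I)
  \<comment> \<open>The factor \<open>jmat p\<close> keeps the upper half and gives
    \<open>jmat p *\<^sub>v x = adj \<gamma> *\<^sub>v a\<close>, so that the mixed terms with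
    \<open>y\<close> reduce to \<open>\<gamma> *\<^sub>v y\<close>, which is 0.\<close>
  define x where "x = jmat p *\<^sub>v (adj \<gamma> *\<^sub>v a)"
  have x [simp]: "dim_vec x = 2 * p" by (simp add: x_def)
  have jx: "jmat p *\<^sub>v x = adj \<gamma> *\<^sub>v a"
    unfolding x_def
    by (subst mat_vec_assoc[symmetric]) (auto intro!: one_mult_mat_vec carrier_vecI)
  have x1: "x $ i = (adj \<gamma> *\<^sub>v a) $ i" if "i < p" for i
  proof -
    have "x $ i = (\<Sum>k<2 * p. (if i = k then if i < p then 1 else - 1 else 0) * (adj \<gamma> *\<^sub>v a) $ k)"
      using that by (simp add: x_def scalar_prod_def[of "row (jmat p) i"] atLeast0LessThan jmat_index)
    also have "\<dots> = (\<Sum>k<2 * p. if k = i then (adj \<gamma> *\<^sub>v a) $ k else 0)"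
      using that by (intro sum.cong) auto
    finally show ?thesis using that by simp
  qed
  have w1: "(x + y) $ i = 0" if "i < p" for i
    using that Gv[of a i] Ga x1[of i] by (simp add: vec_first_def eq_neg_iff_add_eq_0 neg_eq_iff_add_eq_0 add.commute)
  have xx: "ip x (jmat p *\<^sub>v x) = ip a a"
    using form[of a] unfolding jx by (simp add: x_def ip_adj)
  have yx: "ip y (jmat p *\<^sub>v x) = 0"
    unfolding jx by (simp add: ip_adj \<gamma>y) (simp add: ip_def)
  have xy: "ip x (jmat p *\<^sub>v y) = 0"
  proof -
    have "ip x (jmat p *\<^sub>v y) = ip (adj \<gamma> *\<^sub>v a) y"
      by (simp add: ip_adj jx)
    also have "\<dots> = ip a (\<gamma> *\<^sub>v y)"
      by (simp add: ip_adj)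
    finally show ?thesis by (simp add: \<gamma>y ip_def)
  qed
  have "ip a a + ip y (jmat p *\<^sub>v y) = ip (x + y) (jmat p *\<^sub>v (x + y))"
    by (simp add: mat_vec_add ip_add_left ip_add_right xx xy yx)
  also have "\<dots> = - ip (x + y) (x + y)"
    by (rule ip_jmat_lower_half[OF _ w1]) simp_all
  finally have eq: "Re (ip y (jmat p *\<^sub>v y)) = - Re (ip (x + y) (x + y)) - Re (ip a a)"
    by (simp add: complex_eq_iff)
  show "Re (ip y (jmat p *\<^sub>v y)) \<le> 0"
    unfolding eq using Re_ip_self_nonneg[of "x + y"] Re_ip_self_nonneg[of a] by simp
  assume "Re (ip y (jmat p *\<^sub>v y)) = 0"
  hence "Re (ip (x + y) (x + y)) \<le> 0" "Re (ip a a) \<le> 0"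
    unfolding eq using Re_ip_self_nonneg[of "x + y"] Re_ip_self_nonneg[of a] by auto
  hence xy0: "x + y = 0\<^sub>v (2 * p)" and a0: "a = 0\<^sub>v p"
    using Re_ip_self_zeroD[of "x + y" "2 * p"] Re_ip_self_zeroD[of a p] by simp_all
  have "x = 0\<^sub>v (2 * p)"
    unfolding x_def a0 by (intro eq_vecI) (auto simp: scalar_prod_def)
  thus "y = 0\<^sub>v (2 * p)" using xy0 y by simp
qed

text \<open>The matrix \<open>jmat p * adj \<gamma> * \<gamma>\<close> is the j-orthogonal
  projection onto a j-positive subspace of dimension p, whose j-orthogonal complement is j-negative.
  \<open>C\<close> is the form j with its sign reversed on that complement, hence positive.\<close>

lemma two_gamma_minus_j:
  assumes \<gamma>: "\<gamma> \<in> carrier_mat p (2 * p)" and \<gamma>j: "\<gamma> * jmat p * adj \<gamma> = 1\<^sub>m p"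
  defines "C \<equiv> 2 \<cdot>\<^sub>m (adj \<gamma> * \<gamma>) - jmat p"
  shows "adj C = C" "C * jmat p * C = jmat p" "pos_def (2 * p) C"
proof -
  have dims [simp]: "dim_row \<gamma> = p" "dim_col \<gamma> = 2 * p"
    using \<gamma> by auto
  have C: "C \<in> carrier_mat (2 * p) (2 * p)" by (auto simp: C_def)
  show adjC: "adj C = C"
    by (simp add: C_def mat_ring_simps)
  have \<gamma>j': "\<gamma> * (jmat p * (adj \<gamma> * X)) = X" if "dim_row X = p" for X
  proof -
    have "\<gamma> * (jmat p * (adj \<gamma> * X)) = (\<gamma> * jmat p * adj \<gamma>) * X"
      using that by (simp add: mat_mult_assoc)
    thus ?thesis using that by (simp add: \<gamma>j mat_one_mult)
  qed
  have jj: "jmat p * (jmat p * X) = X" if "dim_row X = 2 * p" for X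
  proof -
    have "jmat p * (jmat p * X) = (jmat p * jmat p) * X"
      using that by (simp add: mat_mult_assoc del: jmat_square)
    thus ?thesis using that by (simp add: mat_one_mult)
  qed
  define X where "X = adj \<gamma> * \<gamma>"
  have X [simp]: "dim_row X = 2 * p" "dim_col X = 2 * p" and adjX: "adj X = X"
    by (simp_all add: X_def adj_mult)
  have XjX: "X * (jmat p * X) = X"
    by (simp add: X_def mat_mult_assoc \<gamma>j')
  have CX: "C = 2 \<cdot>\<^sub>m X - jmat p"
    by (simp add: C_def X_def)
  show "C * jmat p * C = jmat p"
    unfolding CX by (rule eq_matI) (simp_all add: mat_ring_simps XjX jj del: index_mult_mat(1))
  show "pos_def (2 * p) C"
    unfolding pos_def_iff_ip
  proof (intro conjI ballI impI C adjC)
    fix x :: "complex vec" assume x: "x \<in> carrier_vec (2 * p)" and x0: "x \<noteq> 0\<^sub>v (2 * p)"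
    have dx [simp]: "dim_vec x = 2 * p" using x by auto
    \<comment> \<open>The projection onto the kernel of \<gamma>. The form j splits as
      \<open>X + adj Z * (jmat p * Z)\<close>, and \<open>C\<close> as the difference of the same
      two terms.\<close>
    define Z where "Z = 1\<^sub>m (2 * p) - jmat p * X"
    have dZ [simp]: "dim_row Z = 2 * p" "dim_col Z = 2 * p" by (simp_all add: Z_def)
    have \<gamma>Z: "\<gamma> * Z = 0\<^sub>m p (2 * p)"
      unfolding Z_def X_def
      by (rule eq_matI) (simp_all add: mat_ring_simps \<gamma>j' del: index_mult_mat(1))
    have CZ: "C = X - adj Z * (jmat p * Z)"
      unfolding Z_def CX
      by (rule eq_matI) (simp_all add: mat_ring_simps adjX XjX jj del: index_mult_mat(1))
    define y where "y = Z *\<^sub>v x"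
    have y: "y \<in> carrier_vec (2 * p)" by (auto simp: y_def intro: carrier_vecI)
    have "\<gamma> *\<^sub>v y = (\<gamma> * Z) *\<^sub>v x"
      unfolding y_def by (simp add: mat_vec_assoc)
    hence \<gamma>y: "\<gamma> *\<^sub>v y = 0\<^sub>v p"
      unfolding \<gamma>Z by (auto intro!: eq_vecI simp: scalar_prod_def)
    note neg = j_orthogonal_complement_negative[OF \<gamma> \<gamma>j y \<gamma>y]
    have "C *\<^sub>v x = adj \<gamma> *\<^sub>v (\<gamma> *\<^sub>v x) - adj Z *\<^sub>v (jmat p *\<^sub>v y)"
      unfolding CZ y_def X_def using x
      by (subst minus_mult_distrib_mat_vec[of _ "2 * p" "2 * p"]) (auto simp: mat_vec_assoc)
    moreover have "ip x (u - v) = ip x u - ip x v" if "dim_vec u = 2 * p" "dim_vec v = 2 * p" for u v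
      using that by (simp add: ip_def algebra_simps sum_subtractf)
    ultimately have "ip x (C *\<^sub>v x) = ip (\<gamma> *\<^sub>v x) (\<gamma> *\<^sub>v x) - ip y (jmat p *\<^sub>v y)"
      using y by (simp add: ip_adj[of _ "adj \<gamma>"] ip_adj[of _ "adj Z"] y_def)
    hence eq: "Re (ip x (C *\<^sub>v x)) = Re (ip (\<gamma> *\<^sub>v x) (\<gamma> *\<^sub>v x)) - Re (ip y (jmat p *\<^sub>v y))"
      by simp
    show "0 < Re (ip x (C *\<^sub>v x))"
    proof (rule ccontr)
      assume "\<not> ?thesis"
      hence "Re (ip (\<gamma> *\<^sub>v x) (\<gamma> *\<^sub>v x)) \<le> 0" "Re (ip y (jmat p *\<^sub>v y)) = 0"
        unfolding eq using neg(1) Re_ip_self_nonneg[of "\<gamma> *\<^sub>v x"] by auto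
      hence \<gamma>x: "\<gamma> *\<^sub>v x = 0\<^sub>v p" and y0: "y = 0\<^sub>v (2 * p)"
        using Re_ip_self_zeroD[of "\<gamma> *\<^sub>v x" p] neg(2) by auto
      have "y = x - jmat p *\<^sub>v (adj \<gamma> *\<^sub>v (\<gamma> *\<^sub>v x))"
        unfolding y_def Z_def X_def using x
        by (subst minus_mult_distrib_mat_vec[of _ "2 * p" "2 * p"]) (auto simp: mat_vec_assoc)
      also have "jmat p *\<^sub>v (adj \<gamma> *\<^sub>v (\<gamma> *\<^sub>v x)) = 0\<^sub>v (2 * p)"
        unfolding \<gamma>x by (intro eq_vecI) (auto simp: scalar_prod_def)
      finally show False using y0 x x0 by simp
    qed
  qed
qed

text \<open>Since \<open>Kmat p * jmat p * adj (Kmat p) = Jmat p\<close>, the normalization of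
  \<open>\<beta> k\<close> with respect to J is that of \<open>\<beta> k * Kmat p\<close> with
  respect to j.\<close>

lemma Cmat_properties:
  assumes \<beta>: "\<beta> k \<in> carrier_mat p (2 * p)" and \<beta>J: "\<beta> k * Jmat p * adj (\<beta> k) = 1\<^sub>m p"
  shows "adj (Cmat p \<beta> k) = Cmat p \<beta> k" "Cmat p \<beta> k * jmat p * Cmat p \<beta> k = jmat p"
    "pos_def (2 * p) (Cmat p \<beta> k)"
proof -
  have dims [simp]: "dim_row (\<beta> k) = p" "dim_col (\<beta> k) = 2 * p"
    using \<beta> by auto
  have "(\<beta> k * Kmat p) * jmat p * adj (\<beta> k * Kmat p) =
      \<beta> k * (Kmat p * (jmat p * adj (Kmat p))) * adj (\<beta> k)"
    by (simp add: mat_mult_assoc adj_mult)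
  hence "(\<beta> k * Kmat p) * jmat p * adj (\<beta> k * Kmat p) = 1\<^sub>m p"
    by (simp only: Kmat_jmat_adj \<beta>J)
  moreover have "Cmat p \<beta> k = 2 \<cdot>\<^sub>m (adj (\<beta> k * Kmat p) * (\<beta> k * Kmat p)) - jmat p"
    by (simp add: Cmat_def mat_mult_assoc adj_mult)
  moreover have "\<beta> k * Kmat p \<in> carrier_mat p (2 * p)"
    by auto
  ultimately show "adj (Cmat p \<beta> k) = Cmat p \<beta> k" "Cmat p \<beta> k * jmat p * Cmat p \<beta> k = jmat p"
    "pos_def (2 * p) (Cmat p \<beta> k)"
    using two_gamma_minus_j[of "\<beta> k * Kmat p" p] by simp_all
qed

section \<open>Division along a chain of projections\<close>

interpretation fps_const_hom: comm_ring_hom "fps_const :: complex \<Rightarrow> complex fps"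
  by unfold_locales auto

interpretation fps_nth_0_hom: comm_ring_hom "\<lambda>f :: complex fps. fps_nth f 0"
  by unfold_locales auto

abbreviation const_mat :: "complex mat \<Rightarrow> complex fps mat" where
  "const_mat \<equiv> map_mat fps_const"

abbreviation at_0 :: "complex fps mat \<Rightarrow> complex mat" where
  "at_0 \<equiv> map_mat (\<lambda>f. fps_nth f 0)"

lemma const_mat_mult: "dim_col A = dim_row B \<Longrightarrow> const_mat (A * B) = const_mat A * const_mat B"
  by (rule fps_const_hom.mat_hom_mult[of _ "dim_row A" "dim_row B" _ "dim_col B"]) auto

lemma at_0_mult: "dim_col A = dim_row B \<Longrightarrow> at_0 (A * B) = at_0 A * at_0 B"
  by (rule fps_nth_0_hom.mat_hom_mult[of _ "dim_row A" "dim_row B" _ "dim_col B"]) auto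

lemma at_0_const_mat [simp]: "at_0 (const_mat A) = A"
  by (rule eq_matI) auto

definition proj_factor :: "nat \<Rightarrow> complex mat \<Rightarrow> complex fps mat" where
  "proj_factor n P = 1\<^sub>m n + (fps_X - 1) \<cdot>\<^sub>m const_mat P"

lemma proj_factor_dim [simp]:
  "dim_row P = n \<Longrightarrow> dim_row (proj_factor n P) = n" "dim_col P = n \<Longrightarrow> dim_col (proj_factor n P) = n"
  by (simp_all add: proj_factor_def)

lemma at_0_proj_factor:
  "dim_row P = n \<Longrightarrow> dim_col P = n \<Longrightarrow> at_0 (proj_factor n P) = 1\<^sub>m n - P"
  by (rule eq_matI) (auto simp: proj_factor_def)

text \<open>Division by 1 - X sums coefficients, and the remainder of order n + 1 is invisible up to
  index n.\<close>

lemma fps_mult_one_minus_X_nth: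
  fixes f h r :: "complex fps"
  assumes "(1 - fps_X) * f = h - fps_X ^ Suc n * r" "k \<le> n"
  shows "fps_nth f k = (\<Sum>q\<le>k. fps_nth h q)"
  using assms(2)
proof (induction k)
  case 0
  have "fps_nth ((1 - fps_X) * f) 0 = fps_nth (h - fps_X ^ Suc n * r) 0"
    by (simp only: assms(1))
  thus ?case by simp
next
  case (Suc k)
  have "fps_nth ((1 - fps_X) * f) (Suc k) = fps_nth (h - fps_X ^ Suc n * r) (Suc k)"
    by (simp only: assms(1))
  moreover have "fps_nth (fps_X ^ Suc n * r) (Suc k) = 0"
    using Suc.prems by (subst fps_X_power_mult_nth) auto
  ultimately have "fps_nth f (Suc k) = fps_nth f k + fps_nth h (Suc k)"
    by (simp add: left_diff_distrib algebra_simps)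
  thus ?case using Suc by simp
qed

text \<open>The square matrix \<open>[V c]\<close> has the left inverse with block rows \<open>E * (1 - c * b)\<close> and \<open>b\<close>,
  hence also this right inverse.\<close>

lemma complementary_projection:
  fixes V E c b :: "complex mat"
  assumes V: "V \<in> carrier_mat (2 * p) p" and E: "E \<in> carrier_mat p (2 * p)"
    and c: "c \<in> carrier_mat (2 * p) p" and b: "b \<in> carrier_mat p (2 * p)"
    and EV: "E * V = 1\<^sub>m p" and bc: "b * c = 1\<^sub>m p" and bV: "b * V = 0\<^sub>m p p"
  shows "V * (E * (1\<^sub>m (2 * p) - c * b)) = 1\<^sub>m (2 * p) - c * b"
proof -
  have dims [simp]: "dim_row V = 2 * p" "dim_col V = p" "dim_row E = p" "dim_col E = 2 * p"
    "dim_row c = 2 * p" "dim_col c = p" "dim_row b = p" "dim_col b = 2 * p"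
    using V E b c by auto
  define E' where "E' = E * (1\<^sub>m (2 * p) - c * b)"
  have E': "E' \<in> carrier_mat p (2 * p)" by (auto simp: E'_def)
  have E'V: "E' * V = 1\<^sub>m p"
    unfolding E'_def
    by (simp add: mat_ring_simps EV bV) (auto intro!: eq_matI)
  have E'c: "E' * c = 0\<^sub>m p p"
    unfolding E'_def
    by (simp add: mat_ring_simps bc) (auto intro!: eq_matI)
  \<comment> \<open>Blocks without rows or columns turn \<open>four_block_mat\<close> into mere
    juxtaposition: \<open>?M\<close> is \<open>[V c]\<close> and \<open>?L\<close> is
    \<open>E'\<close> on top of \<open>b\<close>. Both are square of size 2p, so a left inverse is a
    right inverse.\<close>
  let ?M = "four_block_mat V c (0\<^sub>m 0 p) (0\<^sub>m 0 p)"
  let ?L = "four_block_mat E' (0\<^sub>m p 0) b (0\<^sub>m p 0)"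
  have "?L * ?M = four_block_mat (E' * V + 0\<^sub>m p 0 * 0\<^sub>m 0 p) (E' * c + 0\<^sub>m p 0 * 0\<^sub>m 0 p)
     (b * V + 0\<^sub>m p 0 * 0\<^sub>m 0 p) (b * c + 0\<^sub>m p 0 * 0\<^sub>m 0 p)"
    by (rule mult_four_block_mat[OF E' _ b _ V c]) auto
  also have "\<dots> = 1\<^sub>m (2 * p)"
    unfolding E'V E'c bV bc by (rule eq_matI) auto
  finally have "?M * ?L = 1\<^sub>m (2 * p)"
    by (intro mat_mult_left_right_inverse[of ?L "2 * p" ?M])
       (use E' in auto)
  moreover have "?M * ?L = four_block_mat (V * E' + c * b) (V * 0\<^sub>m p 0 + c * 0\<^sub>m p 0)
     (0\<^sub>m 0 p * E' + 0\<^sub>m 0 p * b) (0\<^sub>m 0 p * 0\<^sub>m p 0 + 0\<^sub>m 0 p * 0\<^sub>m p 0)"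
    by (rule mult_four_block_mat[OF V c _ _ E' _ b]) auto
  ultimately have eq: "four_block_mat (V * E' + c * b) (V * 0\<^sub>m p 0 + c * 0\<^sub>m p 0)
     (0\<^sub>m 0 p * E' + 0\<^sub>m 0 p * b) (0\<^sub>m 0 p * 0\<^sub>m p 0 + 0\<^sub>m 0 p * 0\<^sub>m p 0) = 1\<^sub>m (2 * p)"
    by simp
  have dE' [simp]: "dim_row E' = p" "dim_col E' = 2 * p" using E' by auto
  have ent: "(V * E') $$ (i, k) + (c * b) $$ (i, k) = 1\<^sub>m (2 * p) $$ (i, k)"
    if "i < 2 * p" "k < 2 * p" for i k
    using arg_cong[OF eq, of "\<lambda>A. A $$ (i, k)"] that by simp
  have "V * E' = 1\<^sub>m (2 * p) - c * b"
    by (rule eq_matI) (use ent in \<open>simp_all add: algebra_simps del: index_mult_mat(1) index_one_mat(1)\<close>)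
  thus ?thesis by (simp add: E'_def)
qed

lemma fps_X_smult_eq_0:
  fixes A :: "complex fps mat"
  assumes "fps_X \<cdot>\<^sub>m A = 0\<^sub>m n m"
  shows "A = 0\<^sub>m n m"
proof -
  have dims: "dim_row A = n" "dim_col A = m"
    using arg_cong[OF assms, of dim_row] arg_cong[OF assms, of dim_col] by auto
  have "fps_X * A $$ (i, k) = 0" if "i < n" "k < m" for i k
    using arg_cong[OF assms, of "\<lambda>A. A $$ (i, k)"] that dims by simp
  thus ?thesis using dims by (intro eq_matI) auto
qed

lemma fps_X_smult_cancel:
  fixes A B :: "complex fps mat"
  assumes "fps_X \<cdot>\<^sub>m A = fps_X \<cdot>\<^sub>m B"
  shows "A = B"
proof -
  have dims: "dim_row A = dim_row B" "dim_col A = dim_col B"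
    using arg_cong[OF assms, of dim_row] arg_cong[OF assms, of dim_col] by auto
  have "fps_X * A $$ (i, k) = fps_X * B $$ (i, k)" if "i < dim_row B" "k < dim_col B" for i k
    using arg_cong[OF assms, of "\<lambda>A. A $$ (i, k)"] that dims by simp
  thus ?thesis using dims by (intro eq_matI) auto
qed

text \<open>The algebraic core: J is forgotten, and only the projections \<open>c k * b k\<close>
  remain. \<open>E\<close> and \<open>E'\<close> are one-sided inverses that express that
  \<open>V 0\<close> and \<open>g0\<close> have full rank p at 0.\<close>

locale projection_chain =
  fixes p N :: nat and b c :: "nat \<Rightarrow> complex mat" and V :: "nat \<Rightarrow> complex fps mat"
    and g0 :: "complex fps mat" and E E' :: "complex mat"
  assumes b: "\<And>k. k \<le> N \<Longrightarrow> b k \<in> carrier_mat p (2 * p)"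
    and c: "\<And>k. k \<le> N \<Longrightarrow> c k \<in> carrier_mat (2 * p) p"
    and bc: "\<And>k. k \<le> N \<Longrightarrow> b k * c k = 1\<^sub>m p"
    and V: "\<And>k. k \<le> Suc N \<Longrightarrow> V k \<in> carrier_mat (2 * p) p"
    and V_step: "\<And>k. k \<le> N \<Longrightarrow> V k = proj_factor (2 * p) (c k * b k) * V (Suc k)"
    and g0: "g0 \<in> carrier_mat p (2 * p)"
    and g0_V: "g0 * V 0 = 0\<^sub>m p p"
    and E: "E \<in> carrier_mat p (2 * p)" and E_V: "E * at_0 (V 0) = 1\<^sub>m p"
    and E': "E' \<in> carrier_mat (2 * p) p" and g0_E': "at_0 g0 * E' = 1\<^sub>m p"
begin

lemma bc_dims [simp]: "k \<le> N \<Longrightarrow> dim_row (b k) = p" "k \<le> N \<Longrightarrow> dim_col (b k) = 2 * p"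
  "k \<le> N \<Longrightarrow> dim_row (c k) = 2 * p" "k \<le> N \<Longrightarrow> dim_col (c k) = p"
  using b[of k] c[of k] by auto

lemma V_dims [simp]: "k \<le> Suc N \<Longrightarrow> dim_row (V k) = 2 * p" "k \<le> Suc N \<Longrightarrow> dim_col (V k) = p"
  using V[of k] by auto

lemma g0_dims [simp]: "dim_row g0 = p" "dim_col g0 = 2 * p"
  using g0 by auto

lemma E'_dims [simp]: "dim_row E' = 2 * p" "dim_col E' = p"
  using E' by auto

abbreviation F :: "nat \<Rightarrow> complex fps mat" where
  "F k \<equiv> proj_factor (2 * p) (c k * b k)"

lemma at_0_V_step: "k \<le> N \<Longrightarrow> at_0 (V k) = (1\<^sub>m (2 * p) - c k * b k) * at_0 (V (Suc k))"
  by (subst V_step) (simp_all add: at_0_mult at_0_proj_factor)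

lemma F_c: "k \<le> N \<Longrightarrow> F k * const_mat (c k) = fps_X \<cdot>\<^sub>m const_mat (c k)"
  unfolding proj_factor_def
  by (simp add: mat_ring_simps const_mat_mult[symmetric] bc) (auto intro!: eq_matI simp: algebra_simps)

text \<open>\<open>at_0 (V k)\<close> factors through \<open>at_0 (V (Suc k))\<close>, so a left
  inverse of the former, times that factor, is one of the latter.\<close>

lemma V_left_inverse:
  "k \<le> Suc N \<Longrightarrow> \<exists>L \<in> carrier_mat p (2 * p). L * at_0 (V k) = 1\<^sub>m p"
proof (induction k)
  case 0
  show ?case using E E_V by blast
next
  case (Suc k)
  then obtain L where L: "L \<in> carrier_mat p (2 * p)" "L * at_0 (V k) = 1\<^sub>m p" by auto
  have "L * (1\<^sub>m (2 * p) - c k * b k) * at_0 (V (Suc k)) = L * at_0 (V k)"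
    using L(1) Suc.prems by (subst at_0_V_step) (auto simp: mat_mult_assoc)
  thus ?case
    using L Suc.prems by (intro bexI[of _ "L * (1\<^sub>m (2 * p) - c k * b k)"]) auto
qed

text \<open>Equality of two p-dimensional ranges, phrased as a factorization: \<open>b k\<close>
  kills \<open>at_0 (V k)\<close>, whose columns are independent and hence span the whole kernel of
  \<open>b k\<close>.\<close>

lemma range_complement:
  assumes k: "k \<le> N"
  shows "\<exists>Y \<in> carrier_mat p (2 * p). at_0 (V k) * Y = 1\<^sub>m (2 * p) - c k * b k"
proof -
  obtain L where L: "L \<in> carrier_mat p (2 * p)" "L * at_0 (V k) = 1\<^sub>m p"
    using V_left_inverse[of k] k by auto
  have "b k * at_0 (V k) = (b k - (b k * c k) * b k) * at_0 (V (Suc k))"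
    using k by (subst at_0_V_step) (simp_all add: mat_ring_simps)
  hence "b k * at_0 (V k) = 0\<^sub>m p p"
    using k b[of k] by (simp add: bc mat_one_mult)
  hence "at_0 (V k) * (L * (1\<^sub>m (2 * p) - c k * b k)) = 1\<^sub>m (2 * p) - c k * b k"
    using k L by (intro complementary_projection bc) auto
  thus ?thesis
    using k L(1) by (intro bexI[of _ "L * (1\<^sub>m (2 * p) - c k * b k)"]) auto
qed

text \<open>\<open>fps_shift 1\<close> drops the constant term whatever it is, so this is a genuine
  division by X only where \<open>g k * F k\<close> vanishes at 0. That needs
  \<open>g k * V k = 0\<close>, which in turn passes to the next index through the division; hence
  the lemmas below that assume annihilation, followed by the induction that discharges it.\<close>

primrec g :: "nat \<Rightarrow> complex fps mat" where
  "g 0 = g0"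
| "g (Suc k) = map_mat (fps_shift 1) (g k * F k)"

lemma g_dims [simp]: "k \<le> Suc N \<Longrightarrow> dim_row (g k) = p" "k \<le> Suc N \<Longrightarrow> dim_col (g k) = 2 * p"
  by (induction k) auto

lemma at_0_g_if_annihilates:
  assumes k: "k \<le> N" and gV: "g k * V k = 0\<^sub>m p p"
  shows "at_0 (g k) * (1\<^sub>m (2 * p) - c k * b k) = 0\<^sub>m p (2 * p)"
proof -
  obtain Y where Y: "Y \<in> carrier_mat p (2 * p)" "at_0 (V k) * Y = 1\<^sub>m (2 * p) - c k * b k"
    using range_complement[OF k] by auto
  have "at_0 (g k) * (at_0 (V k) * Y) = at_0 (g k * V k) * Y"
    using k Y by (simp add: at_0_mult mat_mult_assoc)
  also have "\<dots> = 0\<^sub>m p (2 * p)"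
    unfolding gV using Y by (auto intro!: eq_matI simp: scalar_prod_def)
  finally show ?thesis by (simp only: Y)
qed

lemma fps_X_g_if_annihilates:
  assumes k: "k \<le> N" and gV: "g k * V k = 0\<^sub>m p p"
  shows "fps_X \<cdot>\<^sub>m g (Suc k) = g k * F k"
proof -
  have "at_0 (g k * F k) = 0\<^sub>m p (2 * p)"
    using k at_0_g_if_annihilates[OF k gV] by (simp add: at_0_mult at_0_proj_factor)
  hence ent: "at_0 (g k * F k) $$ (i, l) = 0\<^sub>m p (2 * p) $$ (i, l)" for i l
    by (simp only:)
  have *: "fps_nth ((g k * F k) $$ (i, l)) 0 = 0" if "i < p" "l < 2 * p" for i l
    using ent[of i l] that k by (simp del: index_mult_mat(1))
  have "fps_X * fps_shift 1 ((g k * F k) $$ (i, l)) = (g k * F k) $$ (i, l)"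
    if "i < p" "l < 2 * p" for i l
    using *[OF that] by (intro fps_ext) (auto simp: fps_X_mult_nth)
  thus ?thesis
    using k by (intro eq_matI) (auto simp del: index_mult_mat(1))
qed

lemma g_annihilates: "k \<le> Suc N \<Longrightarrow> g k * V k = 0\<^sub>m p p"
proof (induction k)
  case 0
  show ?case by (simp add: g0_V)
next
  case (Suc k)
  hence k: "k \<le> N" and gV: "g k * V k = 0\<^sub>m p p" by auto
  have "fps_X \<cdot>\<^sub>m (g (Suc k) * V (Suc k)) = g k * F k * V (Suc k)"
    using k by (simp add: mat_smult_mult[symmetric] fps_X_g_if_annihilates[OF k gV] del: g.simps)
  also have "\<dots> = g k * V k"
    using k by (subst (2) V_step) (simp_all add: mat_mult_assoc)
  finally show ?case
    unfolding gV by (rule fps_X_smult_eq_0)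
qed

lemmas at_0_g = at_0_g_if_annihilates[OF _ g_annihilates[OF le_SucI]]
lemmas fps_X_g = fps_X_g_if_annihilates[OF _ g_annihilates[OF le_SucI]]

text \<open>The columns of \<open>c k\<close> are eigenvectors of \<open>F k\<close> with eigenvalue
  X, and this X is the one divided out in \<open>g (Suc k)\<close>.\<close>

lemma g_Suc_c: "k \<le> N \<Longrightarrow> g (Suc k) * const_mat (c k) = g k * const_mat (c k)"
proof (rule fps_X_smult_cancel)
  assume k: "k \<le> N"
  have "fps_X \<cdot>\<^sub>m (g (Suc k) * const_mat (c k)) = g k * (F k * const_mat (c k))"
    using k by (simp add: mat_smult_mult[symmetric] fps_X_g mat_mult_assoc del: g.simps)
  thus "fps_X \<cdot>\<^sub>m (g (Suc k) * const_mat (c k)) = fps_X \<cdot>\<^sub>m (g k * const_mat (c k))"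
    using k by (simp add: F_c mat_mult_smult del: g.simps)
qed

abbreviation D :: "nat \<Rightarrow> complex mat" where
  "D k \<equiv> at_0 (g k) * c k"

lemma D_b: "k \<le> N \<Longrightarrow> D k * b k = at_0 (g k)"
proof -
  assume k: "k \<le> N"
  have "at_0 (g k) - D k * b k = 0\<^sub>m p (2 * p)"
    using at_0_g[OF k k] k by (simp add: mat_ring_simps)
  hence "(at_0 (g k) - D k * b k) $$ (i, l) = 0" if "i < p" "l < 2 * p" for i l
    using that by simp
  thus ?thesis using k by (intro eq_matI) (auto simp del: index_mult_mat(1))
qed

text \<open>Both sides are the value at 0 of \<open>g (Suc k)\<close> applied to \<open>c k\<close>:
  on the left by \<open>D_b\<close>, on the right by \<open>g_Suc_c\<close>.\<close>

lemma D_Suc: "k < N \<Longrightarrow> D (Suc k) * (b (Suc k) * c k) = D k"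
proof -
  assume k: "k < N"
  have "D (Suc k) * (b (Suc k) * c k) = D (Suc k) * b (Suc k) * c k"
    using k by (simp add: mat_mult_assoc del: g.simps)
  also have "\<dots> = at_0 (g (Suc k) * const_mat (c k))"
    using k by (subst D_b) (simp_all add: at_0_mult del: g.simps)
  also have "\<dots> = D k"
    using k by (subst g_Suc_c) (simp_all add: at_0_mult)
  finally show ?thesis .
qed

text \<open>At k = 0, \<open>D 0 * b 0\<close> has the right inverse \<open>E'\<close>. Upwards, the
  factorization of \<open>D k\<close> in \<open>D_Suc\<close> has two square factors, and
  invertibility of the product passes to each: to \<open>D (Suc k)\<close> here, to
  \<open>b (Suc k) * c k\<close> in \<open>det_b_c\<close>.\<close>

lemma det_D: "k \<le> N \<Longrightarrow> det (D k) \<noteq> 0"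
proof (induction k)
  case 0
  have "D 0 * (b 0 * E') = D 0 * b 0 * E'"
    by (simp add: mat_mult_assoc)
  also have "\<dots> = 1\<^sub>m p"
    by (subst D_b) (simp_all add: g0_E')
  finally have "det (D 0 * (b 0 * E')) = 1" by simp
  moreover have "det (D 0 * (b 0 * E')) = det (D 0) * det (b 0 * E')"
    by (rule det_mult[of _ p]) auto
  ultimately show ?case by auto
next
  case (Suc k)
  have "det (D k) = det (D (Suc k) * (b (Suc k) * c k))"
    using D_Suc[of k] Suc.prems by simp
  also have "\<dots> = det (D (Suc k)) * det (b (Suc k) * c k)"
    using Suc.prems by (intro det_mult[of _ p] carrier_matI) simp_all
  finally show ?case using Suc by auto
qed

lemma det_b_c:
  assumes k: "k < N"
  shows "det (b (Suc k) * c k) \<noteq> 0"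
proof -
  have "det (D (Suc k) * (b (Suc k) * c k)) = det (D (Suc k)) * det (b (Suc k) * c k)"
    using k by (intro det_mult[of _ p] carrier_matI) simp_all
  moreover have "det (D k) \<noteq> 0"
    using k by (intro det_D) auto
  ultimately show ?thesis
    by (simp add: D_Suc[OF k] del: g.simps)
qed

text \<open>The power of X restores what the k divisions removed. It makes the sum below telescope
  and pushes the expansion of \<open>t k\<close> to order at least k, which is the block lower
  triangular shape of the later matrix \<open>T\<close>.\<close>

definition t :: "nat \<Rightarrow> complex fps mat" where
  "t k = fps_X ^ k \<cdot>\<^sub>m (g k * const_mat (c k))"

lemma t_dims [simp]: "k \<le> N \<Longrightarrow> dim_row (t k) = p" "k \<le> N \<Longrightarrow> dim_col (t k) = p"
  by (simp_all add: t_def)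

text \<open>This is \<open>(1 - X) * c k * b k = 1 - F k\<close> multiplied by \<open>g k\<close>,
  together with \<open>g k * F k = X * g (Suc k)\<close>. The free right factor \<open>M\<close>
  will be J, to obtain \<Pi>, and \<open>c l\<close>, to obtain the intertwining relation.\<close>

lemma t_step:
  assumes k: "k \<le> N" and M: "dim_row M = 2 * p" and ij: "i < p" "j < dim_col M"
  shows "(1 - fps_X) * (t k * const_mat (b k * M)) $$ (i, j) =
     fps_X ^ k * (g k * const_mat M) $$ (i, j) - fps_X ^ Suc k * (g (Suc k) * const_mat M) $$ (i, j)"
proof -
  let ?Y = "g k * (const_mat (c k * b k) * const_mat M)"
  have "fps_X \<cdot>\<^sub>m (g (Suc k) * const_mat M) = (fps_X \<cdot>\<^sub>m g (Suc k)) * const_mat M"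
    using k M by (simp add: mat_smult_mult del: g.simps)
  also have "\<dots> = g k * (F k * const_mat M)"
    using k M by (simp add: fps_X_g mat_mult_assoc del: g.simps)
  also have "\<dots> = g k * const_mat M + (fps_X - 1) \<cdot>\<^sub>m ?Y"
    using k M by (simp add: proj_factor_def mat_ring_simps)
  finally have "(fps_X \<cdot>\<^sub>m (g (Suc k) * const_mat M)) $$ (i, j) =
      (g k * const_mat M + (fps_X - 1) \<cdot>\<^sub>m ?Y) $$ (i, j)"
    by simp
  hence eq: "fps_X * (g (Suc k) * const_mat M) $$ (i, j) =
      (g k * const_mat M) $$ (i, j) + (fps_X - 1) * ?Y $$ (i, j)"
    using k M ij by (simp del: g.simps index_mult_mat(1))
  have "t k * const_mat (b k * M) = fps_X ^ k \<cdot>\<^sub>m ?Y"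
    using k M by (simp add: t_def const_mat_mult mat_ring_simps)
  hence tk: "(t k * const_mat (b k * M)) $$ (i, j) = fps_X ^ k * ?Y $$ (i, j)"
    using k M ij by (simp del: index_mult_mat(1))
  have "fps_X ^ Suc k * (g (Suc k) * const_mat M) $$ (i, j) =
      fps_X ^ k * (fps_X * (g (Suc k) * const_mat M) $$ (i, j))"
    by (simp only: power_Suc mult_ac)
  thus ?thesis
    unfolding tk eq by (simp only: ring_distribs mult_ac) simp
qed

lemma t_telescope:
  assumes l: "l \<le> Suc N" and M: "dim_row M = 2 * p" and ij: "i < p" "j < dim_col M"
  shows "(1 - fps_X) * (\<Sum>k = l..N. (t k * const_mat (b k * M)) $$ (i, j)) =
     fps_X ^ l * (g l * const_mat M) $$ (i, j) - fps_X ^ Suc N * (g (Suc N) * const_mat M) $$ (i, j)"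
proof -
  let ?f = "\<lambda>k. fps_X ^ k * (g k * const_mat M) $$ (i, j)"
  have "(1 - fps_X) * (\<Sum>k = l..N. (t k * const_mat (b k * M)) $$ (i, j)) =
      (\<Sum>k = l..N. ?f k - ?f (Suc k))"
    unfolding sum_distrib_left
    by (intro sum.cong refl t_step) (use M ij in auto)
  also have "\<dots> = - (\<Sum>k = l..N. ?f (Suc k) - ?f k)"
    by (simp only: sum_negf[symmetric] minus_diff_eq)
  also have "\<dots> = ?f l - ?f (Suc N)"
    by (subst sum_Suc_diff[OF l]) (simp only: minus_diff_eq)
  finally show ?thesis .
qed

text \<open>The telescoped sum from 0 leaves \<open>g0\<close> up to order N, and division by 1 - X
  turns its coefficients into the partial sums that fill \<Pi>.\<close>

lemma t_sum_nth:
  assumes M: "dim_row M = 2 * p" and ij: "i < p" "j < dim_col M" and k: "k \<le> N"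
  shows "(\<Sum>l\<le>N. fps_nth ((t l * const_mat (b l * M)) $$ (i, j)) k) =
    (\<Sum>q\<le>k. fps_nth ((g0 * const_mat M) $$ (i, j)) q)"
proof -
  have "fps_nth (\<Sum>l = 0..N. (t l * const_mat (b l * M)) $$ (i, j)) k =
    (\<Sum>q\<le>k. fps_nth ((g0 * const_mat M) $$ (i, j)) q)"
    using t_telescope[of 0, OF _ M ij] by (intro fps_mult_one_minus_X_nth[OF _ k]) simp
  thus ?thesis by (simp only: fps_sum_nth atMost_atLeast0)
qed

text \<open>Telescoping from l + 1 with \<open>M = c l\<close> leaves X times \<open>t l\<close>,
  because \<open>g_Suc_c\<close> replaces \<open>g (Suc l)\<close> by \<open>g l\<close>. The extra
  X makes the resulting partial sum strict, as in the part of A below the diagonal.\<close>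

lemma t_intertwining_nth:
  assumes ij: "i < p" "j < p" and k: "k \<le> N" and l: "l \<le> N"
  shows "(\<Sum>l' = Suc l..N. fps_nth ((t l' * const_mat (b l' * c l)) $$ (i, j)) k) =
    (\<Sum>q<k. fps_nth (t l $$ (i, j)) q)"
proof -
  have "(1 - fps_X) * (\<Sum>l' = Suc l..N. (t l' * const_mat (b l' * c l)) $$ (i, j)) =
     fps_X ^ Suc l * (g (Suc l) * const_mat (c l)) $$ (i, j)
      - fps_X ^ Suc N * (g (Suc N) * const_mat (c l)) $$ (i, j)"
    using l ij by (intro t_telescope) auto
  moreover have "fps_X ^ Suc l * (g (Suc l) * const_mat (c l)) $$ (i, j) = fps_X * t l $$ (i, j)"
    unfolding g_Suc_c[OF l] t_def using l ij by (simp add: mult_ac del: index_mult_mat(1))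
  ultimately have "fps_nth (\<Sum>l' = Suc l..N. (t l' * const_mat (b l' * c l)) $$ (i, j)) k =
     (\<Sum>q\<le>k. fps_nth (fps_X * t l $$ (i, j)) q)"
    by (intro fps_mult_one_minus_X_nth[OF _ k]) (simp only:)
  also have "\<dots> = (\<Sum>q<k. fps_nth (t l $$ (i, j)) q)"
    by (simp add: fps_X_mult_nth sum.atMost_shift)
  finally show ?thesis by (simp only: fps_sum_nth)
qed

lemma t_nth_less: "k < l \<Longrightarrow> l \<le> N \<Longrightarrow> i < p \<Longrightarrow> j < p \<Longrightarrow> fps_nth (t l $$ (i, j)) k = 0"
  by (simp add: t_def fps_X_power_mult_nth del: index_mult_mat(1))

lemma t_nth_diag: "l \<le> N \<Longrightarrow> i < p \<Longrightarrow> j < p \<Longrightarrow> fps_nth (t l $$ (i, j)) l = D l $$ (i, j)"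
proof -
  assume l: "l \<le> N" and ij: "i < p" "j < p"
  have "D l = at_0 (g l * const_mat (c l))"
    using l by (simp add: at_0_mult)
  thus ?thesis
    using l ij by (simp add: t_def fps_X_power_mult_nth del: index_mult_mat(1))
qed

end

section \<open>Block matrices\<close>

lemma sum_blocks:
  fixes f :: "nat \<Rightarrow> 'a::comm_monoid_add"
  shows "(\<Sum>r<n * p. f r) = (\<Sum>k<n. \<Sum>a<p. f (k * p + a))"
proof -
  have "(\<Sum>r<n * p. f r) = (\<Sum>k<n. sum f {k * p..<k * p + p})"
    by (rule sum.nat_group[symmetric])
  also have "\<dots> = (\<Sum>k<n. \<Sum>a<p. f (k * p + a))"
  proof (rule sum.cong[OF refl])
    fix k
    show "sum f {k * p..<k * p + p} = (\<Sum>a<p. f (k * p + a))"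
      by (rule sum.reindex_bij_witness[of _ "\<lambda>a. k * p + a" "\<lambda>r. r - k * p"]) auto
  qed
  finally show ?thesis .
qed

lemma block_index_less: "k < n \<Longrightarrow> a < p \<Longrightarrow> k * p + a < n * (p::nat)"
proof -
  assume "k < n" "a < p"
  hence "k * p + a < Suc k * p" by simp
  also have "\<dots> \<le> n * p" using \<open>k < n\<close> by (intro mult_le_mono1) simp
  finally show ?thesis .
qed

lemma block_indexE:
  assumes "r < n * (p::nat)"
  obtains k a where "k < n" "a < p" "r = k * p + a" "r div p = k" "r mod p = a"
proof
  have p: "p > 0" using assms by (cases p) auto
  show "r div p < n" using assms by (simp add: less_mult_imp_div_less)
  show "r mod p < p" using p by simp
qed auto

lemma index_mult_sum:
  assumes "i < dim_row A" "k < dim_col B" "dim_row B = dim_col A"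
  shows "(A * B) $$ (i, k) = (\<Sum>s<dim_col A. A $$ (i, s) * B $$ (s, k))"
  using assms by (simp add: scalar_prod_def atLeast0LessThan)

text \<open>The induction splits off the last block row and block column. Giving the matrix by one
  index function \<open>f\<close> lets the leading submatrix reuse the same
  \<open>f\<close>.\<close>

lemma det_block_lower_triangular:
  fixes f :: "nat \<times> nat \<Rightarrow> complex"
  assumes "\<And>r c. r < n * p \<Longrightarrow> c < n * p \<Longrightarrow> r div p < c div p \<Longrightarrow> f (r, c) = 0"
  shows "det (mat (n * p) (n * p) f) = (\<Prod>l<n. det (mat p p (\<lambda>(a, b). f (l * p + a, l * p + b))))"
  using assms
proof (induction n)
  case 0
  show ?case by simp
next
  case (Suc n)
  let ?C = "mat p (n * p) (\<lambda>(a, c). f (n * p + a, c))"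
  let ?D = "mat p p (\<lambda>(a, b). f (n * p + a, n * p + b))"
  have zero: "f (i, k) = 0" if "i < n * p" "\<not> k < n * p" "k < n * p + p" for i k
  proof (rule Suc.prems)
    have "p > 0" using that by (cases p) auto
    show "i div p < k div p"
      using that less_mult_imp_div_less[of i n p] div_le_mono[of "n * p" k p] \<open>p > 0\<close> by simp
  qed (use that in auto)
  have split: "mat (Suc n * p) (Suc n * p) f =
      four_block_mat (mat (n * p) (n * p) f) (0\<^sub>m (n * p) p) ?C ?D"
    by (rule eq_matI) (auto simp: zero)
  have det: "det (four_block_mat (mat (n * p) (n * p) f) (0\<^sub>m (n * p) p) ?C ?D) =
      det (mat (n * p) (n * p) f) * det ?D"
    by (rule det_four_block_mat_upper_right_zero) auto
  have IH: "det (mat (n * p) (n * p) f) =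
      (\<Prod>l<n. det (mat p p (\<lambda>(a, b). f (l * p + a, l * p + b))))"
    by (rule Suc.IH, rule Suc.prems) auto
  show ?case
    by (simp only: split det IH prod.lessThan_Suc)
qed

text \<open>The spectra of A and its adjoint are {a} and {cnj a}, which are disjoint. Concretely,
  entry (r, c) of the equation for the difference involves, besides itself with coefficient a - cnj
  a, only entries with smaller index sum.\<close>

lemma sylvester_lower_triangular_unique:
  fixes A S S' :: "complex mat"
  assumes A: "A \<in> carrier_mat n n" and S: "S \<in> carrier_mat n n" and S': "S' \<in> carrier_mat n n"
    and low: "\<And>r c. r < c \<Longrightarrow> c < n \<Longrightarrow> A $$ (r, c) = 0"
    and diag: "\<And>r. r < n \<Longrightarrow> A $$ (r, r) = a" and a: "a \<noteq> cnj a"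
    and eq: "A * S - S * adj A = A * S' - S' * adj A"
  shows "S = S'"
proof -
  have dims [simp]: "dim_row A = n" "dim_col A = n" "dim_row S = n" "dim_col S = n"
    "dim_row S' = n" "dim_col S' = n"
    using A S S' by auto
  define X where "X r c = S $$ (r, c) - S' $$ (r, c)" for r c
  have "r < n \<longrightarrow> c < n \<longrightarrow> X r c = 0" for r c
  proof (induction "r + c" arbitrary: r c rule: less_induct)
    case less
    show ?case
    proof (intro impI)
      assume rc: "r < n" "c < n"
      have IH: "X r' c' = 0" if "r' + c' < r + c" "r' < n" "c' < n" for r' c'
        using less that by blast
      have "(A * S - S * adj A) $$ (r, c) = (A * S' - S' * adj A) $$ (r, c)"
        by (simp only: eq)
      hence "(\<Sum>s<n. A $$ (r, s) * S $$ (s, c)) - (\<Sum>s<n. S $$ (r, s) * cnj (A $$ (c, s))) =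
         (\<Sum>s<n. A $$ (r, s) * S' $$ (s, c)) - (\<Sum>s<n. S' $$ (r, s) * cnj (A $$ (c, s)))"
        using rc by (simp add: scalar_prod_def atLeast0LessThan)
      hence "(\<Sum>s<n. A $$ (r, s) * X s c) = (\<Sum>s<n. X r s * cnj (A $$ (c, s)))"
        by (simp add: X_def right_diff_distrib left_diff_distrib sum_subtractf diff_eq_eq add_diff_eq
            eq_diff_eq algebra_simps)
      moreover have "(\<Sum>s<n. A $$ (r, s) * X s c) = (\<Sum>s<n. if s = r then a * X r c else 0)"
      proof (intro sum.cong refl)
        fix s assume "s \<in> {..<n}"
        thus "A $$ (r, s) * X s c = (if s = r then a * X r c else 0)"
          using rc IH[of s c] low[of r s] diag[of r] by (cases s r rule: linorder_cases) auto
      qed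
      moreover have "(\<Sum>s<n. X r s * cnj (A $$ (c, s))) = (\<Sum>s<n. if s = c then cnj a * X r c else 0)"
      proof (intro sum.cong refl)
        fix s assume "s \<in> {..<n}"
        thus "X r s * cnj (A $$ (c, s)) = (if s = c then cnj a * X r c else 0)"
          using rc IH[of r s] low[of c s] diag[of c] by (cases s c rule: linorder_cases) auto
      qed
      ultimately have "a * X r c = cnj a * X r c"
        using rc by simp
      thus "X r c = 0" using a by simp
    qed
  qed
  thus ?thesis
    by (intro eq_matI) (auto simp: X_def)
qed

lemma Amat_block_index:
  assumes "k \<le> N" "k' \<le> N" "a < p" "a' < p"
  shows "Amat p N $$ (k * p + a, k' * p + a') =
    (if a' = a then if k < k' then 0 else if k' = k then \<i> / 2 else \<i> else 0)"
  using assms block_index_less[of k "Suc N" a p] block_index_less[of k' "Suc N" a' p]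
  by (simp add: Amat_def)

lemma Amat_dims [simp]: "dim_row (Amat p N) = Suc N * p" "dim_col (Amat p N) = Suc N * p"
  by (simp_all add: Amat_def)

lemma Amat_lower_triangular:
  assumes "r < c" "c < Suc N * p"
  shows "Amat p N $$ (r, c) = 0"
proof -
  obtain k a where k: "k < Suc N" "a < p" "c = k * p + a" using assms(2) by (rule block_indexE)
  have "r < Suc N * p" using assms by simp
  then obtain k' a' where k': "k' < Suc N" "a' < p" "r = k' * p + a'" by (rule block_indexE)
  have "k' < k" if "a = a'"
    using assms(1) k k' that by (simp add: mult_less_cancel2)
  thus ?thesis
    using k k' by (simp add: Amat_block_index)
qed

lemma Amat_diag: "r < Suc N * p \<Longrightarrow> Amat p N $$ (r, r) = \<i> / 2"
  by (simp add: Amat_def)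

lemma Bmat_dims [simp]: "dim_row (Bmat p N \<beta>) = Suc N * p" "dim_col (Bmat p N \<beta>) = 2 * p"
  by (simp_all add: Bmat_def)

lemma Bmat_block_index:
  assumes "k \<le> N" "a < p" "c < 2 * p"
  shows "Bmat p N \<beta> $$ (k * p + a, c) = \<beta> k $$ (a, c)"
  using assms block_index_less[of k "Suc N" a p] by (simp add: Bmat_def)

lemma Bmat_form_block_index:
  assumes \<beta>: "\<And>k. k \<le> N \<Longrightarrow> \<beta> k \<in> carrier_mat p (2 * p)"
    and k: "k \<le> N" "l \<le> N" "a < p" "b < p"
  shows "(Bmat p N \<beta> * (Jmat p * adj (Bmat p N \<beta>))) $$ (k * p + a, l * p + b) =
     (\<beta> k * Jmat p * adj (\<beta> l)) $$ (a, b)"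
proof -
  have r: "k * p + a < Suc N * p" "l * p + b < Suc N * p"
    using k block_index_less[of k "Suc N" a p] block_index_less[of l "Suc N" b p] by simp_all
  have "(Bmat p N \<beta> * (Jmat p * adj (Bmat p N \<beta>))) $$ (k * p + a, l * p + b) =
      (\<Sum>s<2 * p. \<beta> k $$ (a, s) * (Jmat p * adj (Bmat p N \<beta>)) $$ (s, l * p + b))"
    using r k by (subst index_mult_sum) (auto simp: Bmat_block_index)
  also have "\<dots> = (\<Sum>s<2 * p. \<beta> k $$ (a, s) * (Jmat p * adj (\<beta> l)) $$ (s, b))"
  proof (intro sum.cong refl)
    fix s assume s: "s \<in> {..<2 * p}"
    have "(Jmat p * adj (Bmat p N \<beta>)) $$ (s, l * p + b) =
       (\<Sum>u<2 * p. Jmat p $$ (s, u) * adj (Bmat p N \<beta>) $$ (u, l * p + b))"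
      using r s by (subst index_mult_sum) auto
    also have "\<dots> = (\<Sum>u<2 * p. Jmat p $$ (s, u) * adj (\<beta> l) $$ (u, b))"
      using r k carrier_matD[OF \<beta>[of l]] by (intro sum.cong refl) (simp add: Bmat_block_index)
    also have "\<dots> = (Jmat p * adj (\<beta> l)) $$ (s, b)"
      using s k carrier_matD[OF \<beta>[of l]] by (subst index_mult_sum) auto
    finally show "\<beta> k $$ (a, s) * (Jmat p * adj (Bmat p N \<beta>)) $$ (s, l * p + b) =
       \<beta> k $$ (a, s) * (Jmat p * adj (\<beta> l)) $$ (s, b)" by simp
  qed
  also have "\<dots> = (\<beta> k * (Jmat p * adj (\<beta> l))) $$ (a, b)"
    using k carrier_matD[OF \<beta>[of l]] carrier_matD[OF \<beta>[of k]] by (subst index_mult_sum) auto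
  also have "\<beta> k * (Jmat p * adj (\<beta> l)) = \<beta> k * Jmat p * adj (\<beta> l)"
    using k carrier_matD[OF \<beta>[of l]] carrier_matD[OF \<beta>[of k]] by (simp add: mat_mult_assoc)
  finally show ?thesis .
qed

lemma mat_sum_carrier:
  assumes "\<And>k. k \<le> N \<Longrightarrow> M k \<in> carrier_mat n n"
  shows "mat_sum n M N \<in> carrier_mat n n"
    and "i < n \<Longrightarrow> j < n \<Longrightarrow> mat_sum n M N $$ (i, j) = (\<Sum>k\<le>N. M k $$ (i, j))"
proof -
  have *: "foldr (+) (map M ks) (0\<^sub>m n n) \<in> carrier_mat n n \<and>
      (i < n \<longrightarrow> j < n \<longrightarrow> foldr (+) (map M ks) (0\<^sub>m n n) $$ (i, j) = sum_list (map (\<lambda>k. M k $$ (i, j)) ks))"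
    if "set ks \<subseteq> {..N}" for ks
    using that
  proof (induction ks)
    case (Cons k ks)
    thus ?case using carrier_matD[OF assms[of k]] by auto
  qed simp
  have "set [0..<Suc N] \<subseteq> {..N}" by auto
  note ** = *[OF this]
  show "mat_sum n M N \<in> carrier_mat n n"
    using ** by (simp add: mat_sum_def)
  show "mat_sum n M N $$ (i, j) = (\<Sum>k\<le>N. M k $$ (i, j))" if "i < n" "j < n"
    using ** that unfolding mat_sum_def
    by (simp add: interv_sum_list_conv_sum_set_nat atLeast0LessThan lessThan_Suc_atMost del: upt_Suc)
qed

lemma Bmat_gram:
  assumes \<beta>: "\<And>k. k \<le> N \<Longrightarrow> \<beta> k \<in> carrier_mat p (2 * p)"
  shows "adj (Bmat p N \<beta>) * Bmat p N \<beta> = mat_sum (2 * p) (\<lambda>k. adj (\<beta> k) * \<beta> k) N"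
proof -
  have car: "adj (\<beta> k) * \<beta> k \<in> carrier_mat (2 * p) (2 * p)" if "k \<le> N" for k
    using \<beta>[OF that] by auto
  note ms = mat_sum_carrier[of N "\<lambda>k. adj (\<beta> k) * \<beta> k", OF car]
  show ?thesis
  proof (rule eq_matI)
    fix i j assume "i < dim_row (mat_sum (2 * p) (\<lambda>k. adj (\<beta> k) * \<beta> k) N)"
      "j < dim_col (mat_sum (2 * p) (\<lambda>k. adj (\<beta> k) * \<beta> k) N)"
    hence ij: "i < 2 * p" "j < 2 * p" using ms(1) by auto
    have "(adj (Bmat p N \<beta>) * Bmat p N \<beta>) $$ (i, j) =
       (\<Sum>r<Suc N * p. adj (Bmat p N \<beta>) $$ (i, r) * Bmat p N \<beta> $$ (r, j))"
      using ij by (subst index_mult_sum) auto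
    also have "\<dots> = (\<Sum>k<Suc N. \<Sum>a<p. adj (Bmat p N \<beta>) $$ (i, k * p + a) * Bmat p N \<beta> $$ (k * p + a, j))"
      by (rule sum_blocks)
    also have "\<dots> = (\<Sum>k\<le>N. \<Sum>a<p. adj (\<beta> k) $$ (i, a) * \<beta> k $$ (a, j))"
      unfolding lessThan_Suc_atMost
    proof (intro sum.cong refl)
      fix k a assume "k \<in> {..N}" "a \<in> {..<p}"
      thus "adj (Bmat p N \<beta>) $$ (i, k * p + a) * Bmat p N \<beta> $$ (k * p + a, j) =
          adj (\<beta> k) $$ (i, a) * \<beta> k $$ (a, j)"
        using ij carrier_matD[OF \<beta>[of k]] block_index_less[of k "Suc N" a p]
        by (simp add: Bmat_block_index)
    qed
    also have "\<dots> = (\<Sum>k\<le>N. (adj (\<beta> k) * \<beta> k) $$ (i, j))"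
    proof (intro sum.cong refl)
      fix k assume "k \<in> {..N}"
      thus "(\<Sum>a<p. adj (\<beta> k) $$ (i, a) * \<beta> k $$ (a, j)) = (adj (\<beta> k) * \<beta> k) $$ (i, j)"
        using ij carrier_matD[OF \<beta>[of k]] by (subst index_mult_sum) auto
    qed
    finally show "(adj (Bmat p N \<beta>) * Bmat p N \<beta>) $$ (i, j) =
       mat_sum (2 * p) (\<lambda>k. adj (\<beta> k) * \<beta> k) N $$ (i, j)"
      using ms(2)[OF _ ij] by simp
  qed (use ms(1) in auto)
qed

section \<open>The solution of the Sylvester equation\<close>

lemma (in projection_chain) bc_index:
  "k \<le> N \<Longrightarrow> i < p \<Longrightarrow> j < p \<Longrightarrow> (b k * c k) $$ (i, j) = (if i = j then 1 else 0)"
  by (simp add: bc del: index_mult_mat(1))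

text \<open>\<open>g0\<close> times J is \<open>[1 G]\<close>, the order of the two block columns of
  \<Pi>. The coefficients of G are prescribed only up to N, so that shorter chains satisfy the same
  assumptions with the same \<alpha>.\<close>

locale J_chain = projection_chain p N "\<lambda>k. \<beta> k * Jmat p" "\<lambda>k. adj (\<beta> k)" V g0 E E'
  for p N :: nat and \<beta> :: "nat \<Rightarrow> complex mat" and V g0 E E' +
  fixes \<alpha> :: "nat \<Rightarrow> complex mat"
  assumes g0_left: "\<And>i j. i < p \<Longrightarrow> j < p \<Longrightarrow>
      (g0 * const_mat (Jmat p)) $$ (i, j) = (if i = j then 1 else 0)"
    and g0_right: "\<And>i j q. i < p \<Longrightarrow> j < p \<Longrightarrow> q \<le> N \<Longrightarrow>
      fps_nth ((g0 * const_mat (Jmat p)) $$ (i, p + j)) q = \<alpha> q $$ (i, j)"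
begin

lemma \<beta>: "k \<le> N \<Longrightarrow> \<beta> k \<in> carrier_mat p (2 * p)"
  using bc_dims(1)[of k] bc_dims(3)[of k] by auto

lemma \<beta>_dims [simp]: "k \<le> N \<Longrightarrow> dim_row (\<beta> k) = p" "k \<le> N \<Longrightarrow> dim_col (\<beta> k) = 2 * p"
  using \<beta>[of k] by auto

text \<open>Block column l lists the Taylor coefficients of \<open>t l\<close> up to order
  N.\<close>

definition T :: "complex mat" where
  "T = mat (Suc N * p) (Suc N * p) (\<lambda>(r, s). fps_nth (t (s div p) $$ (r mod p, s mod p)) (r div p))"

lemma T_dims [simp]: "dim_row T = Suc N * p" "dim_col T = Suc N * p"
  by (simp_all add: T_def)

lemma T_block_index:
  assumes "k \<le> N" "l \<le> N" "i < p" "j < p"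
  shows "T $$ (k * p + i, l * p + j) = fps_nth (t l $$ (i, j)) k"
  using assms block_index_less[of k "Suc N" i p] block_index_less[of l "Suc N" j p]
  by (simp add: T_def)

lemma T_row_sum:
  assumes k: "k \<le> N" "i < p"
  shows "(\<Sum>s<Suc N * p. T $$ (k * p + i, s) * f s) =
     (\<Sum>l\<le>N. \<Sum>j<p. fps_nth (t l $$ (i, j)) k * f (l * p + j))"
  unfolding sum_blocks lessThan_Suc_atMost
  by (intro sum.cong refl) (use k in \<open>simp add: T_block_index\<close>)

lemma t_mult_const_nth:
  assumes "l \<le> N" "i < p" "j < dim_col M" "dim_row M = p"
  shows "fps_nth ((t l * const_mat M) $$ (i, j)) k = (\<Sum>s<p. fps_nth (t l $$ (i, s)) k * M $$ (s, j))"
  using assms by (subst index_mult_sum) (auto simp: fps_sum_nth)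

lemma det_T: "det T \<noteq> 0"
proof -
  have "det T = (\<Prod>l<Suc N. det (mat p p (\<lambda>(i, j). (\<lambda>(r, s).
      fps_nth (t (s div p) $$ (r mod p, s mod p)) (r div p)) (l * p + i, l * p + j))))"
    unfolding T_def
  proof (rule det_block_lower_triangular)
    fix r s assume rs: "r < Suc N * p" "s < Suc N * p" "r div p < s div p"
    obtain l j where "l < Suc N" "j < p" "s div p = l" "s mod p = j" using rs(2) by (rule block_indexE)
    moreover obtain k i where "k < Suc N" "i < p" "r div p = k" "r mod p = i"
      using rs(1) by (rule block_indexE)
    ultimately show "(\<lambda>(r, s). fps_nth (t (s div p) $$ (r mod p, s mod p)) (r div p)) (r, s) = 0"
      using rs(3) by (simp add: t_nth_less)
  qed
  also have "\<dots> = (\<Prod>l<Suc N. det (D l))"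
  proof (intro prod.cong refl arg_cong[where f = det])
    fix l assume "l \<in> {..<Suc N}"
    thus "mat p p (\<lambda>(i, j). (\<lambda>(r, s). fps_nth (t (s div p) $$ (r mod p, s mod p)) (r div p))
        (l * p + i, l * p + j)) = D l"
      by (intro eq_matI) (auto simp: t_nth_diag simp del: index_mult_mat(1))
  qed
  also have "\<dots> \<noteq> 0"
    using det_D by (simp add: prod_zero_iff less_Suc_eq_le del: prod.lessThan_Suc)
  finally show ?thesis .
qed

lemma \<beta>_J_J: "k \<le> N \<Longrightarrow> \<beta> k * Jmat p * Jmat p = \<beta> k"
  by (simp add: mat_mult_assoc mat_one_mult)

lemma T_Bmat: "T * Bmat p N \<beta> = PiMat p N \<alpha>"
proof (rule eq_matI)
  fix r s assume "r < dim_row (PiMat p N \<alpha>)" "s < dim_col (PiMat p N \<alpha>)"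
  hence r: "r < Suc N * p" and s: "s < 2 * p" by (auto simp: PiMat_def)
  obtain k i where k: "k < Suc N" "i < p" "r = k * p + i" "r div p = k" "r mod p = i"
    using r by (rule block_indexE)
  have "(T * Bmat p N \<beta>) $$ (r, s) = (\<Sum>u<Suc N * p. T $$ (r, u) * Bmat p N \<beta> $$ (u, s))"
    using r s by (subst index_mult_sum) auto
  also have "\<dots> = (\<Sum>l\<le>N. \<Sum>j<p. fps_nth (t l $$ (i, j)) k * Bmat p N \<beta> $$ (l * p + j, s))"
    unfolding k(3) by (rule T_row_sum) (use k in auto)
  \<comment> \<open>As J squares to 1, inserting it twice presents \<open>\<beta> l\<close> as the
    chain row \<open>\<beta> l * Jmat p\<close> times the test matrix J.\<close>
  also have "\<dots> = (\<Sum>l\<le>N. fps_nth ((t l * const_mat (\<beta> l * Jmat p * Jmat p)) $$ (i, s)) k)"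
  proof (intro sum.cong refl)
    fix l assume "l \<in> {..N}"
    thus "(\<Sum>j<p. fps_nth (t l $$ (i, j)) k * Bmat p N \<beta> $$ (l * p + j, s)) =
        fps_nth ((t l * const_mat (\<beta> l * Jmat p * Jmat p)) $$ (i, s)) k"
      using k s by (simp add: \<beta>_J_J t_mult_const_nth Bmat_block_index del: index_mult_mat(1))
  qed
  also have "\<dots> = (\<Sum>q\<le>k. fps_nth ((g0 * const_mat (Jmat p)) $$ (i, s)) q)"
    by (rule t_sum_nth) (use k s in auto)
  also have "\<dots> = PiMat p N \<alpha> $$ (r, s)"
  proof (cases "s < p")
    case True
    hence "(\<Sum>q\<le>k. fps_nth ((g0 * const_mat (Jmat p)) $$ (i, s)) q) = (if i = s then 1 else 0)"
      using k by (simp add: g0_left sum.delta del: index_mult_mat(1))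
    thus ?thesis
      using True r s k by (simp add: PiMat_def Phi1_def)
  next
    case False
    define j where "j = s - p"
    have j: "s = p + j" "j < p" using False s by (auto simp: j_def)
    have "(\<Sum>q\<le>k. fps_nth ((g0 * const_mat (Jmat p)) $$ (i, s)) q) = (\<Sum>q\<le>k. \<alpha> q $$ (i, j))"
      unfolding j(1) by (intro sum.cong refl g0_right) (use k j in auto)
    thus ?thesis
      using False r s k j by (simp add: PiMat_def Phi2_def)
  qed
  finally show "(T * Bmat p N \<beta>) $$ (r, s) = PiMat p N \<alpha> $$ (r, s)" .
qed (auto simp: PiMat_def)

abbreviation BJB :: "complex mat" where
  "BJB \<equiv> Bmat p N \<beta> * (Jmat p * adj (Bmat p N \<beta>))"

text \<open>The part of \<i> \<open>BJB\<close> strictly below the block diagonal, plus half of its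
  diagonal blocks, which are \<i> times the identity. As \<open>BJB\<close> is Hermitian,
  subtracting the adjoint restores \<i> \<open>BJB\<close>.\<close>

definition AB :: "complex mat" where
  "AB = mat (Suc N * p) (Suc N * p)
     (\<lambda>(r, s). if s div p < r div p then \<i> * BJB $$ (r, s) else if r = s then \<i> / 2 else 0)"

lemma AB_dims [simp]: "dim_row AB = Suc N * p" "dim_col AB = Suc N * p"
  by (simp_all add: AB_def)

lemma AB_block_index:
  assumes "k \<le> N" "l \<le> N" "i < p" "j < p"
  shows "AB $$ (k * p + i, l * p + j) =
    (if l < k then \<i> * (\<beta> k * Jmat p * adj (\<beta> l)) $$ (i, j) else if k = l \<and> i = j then \<i> / 2 else 0)"
proof -
  have "k * p + i = l * p + j \<longleftrightarrow> k = l \<and> i = j"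
    by (metis assms(3,4) add_diff_cancel_left' div_mult_self3 less_nat_zero_code mod_less mod_mult_self3
        div_less add.right_neutral)
  thus ?thesis
    using assms block_index_less[of k "Suc N" i p] block_index_less[of l "Suc N" j p]
    by (simp add: AB_def Bmat_form_block_index[OF \<beta>] del: index_mult_mat(1))
qed

lemma AB_minus_adj: "AB - adj AB = \<i> \<cdot>\<^sub>m BJB"
proof (rule eq_matI)
  fix r s assume "r < dim_row (\<i> \<cdot>\<^sub>m BJB)" "s < dim_col (\<i> \<cdot>\<^sub>m BJB)"
  hence rs: "r < Suc N * p" "s < Suc N * p" by auto
  obtain l j where l: "l < Suc N" "j < p" "s = l * p + j" using rs(2) by (rule block_indexE)
  obtain k i where k: "k < Suc N" "i < p" "r = k * p + i" using rs(1) by (rule block_indexE)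
  have herm: "cnj ((\<beta> l * Jmat p * adj (\<beta> k)) $$ (j, i)) = (\<beta> k * Jmat p * adj (\<beta> l)) $$ (i, j)"
  proof -
    have "adj (\<beta> l * Jmat p * adj (\<beta> k)) = \<beta> k * Jmat p * adj (\<beta> l)"
      using k l by (simp add: mat_ring_simps)
    moreover have "adj (\<beta> l * Jmat p * adj (\<beta> k)) $$ (i, j) = cnj ((\<beta> l * Jmat p * adj (\<beta> k)) $$ (j, i))"
      using k l by (intro index_adj) auto
    ultimately show ?thesis by simp
  qed
  have "(\<i> \<cdot>\<^sub>m BJB) $$ (r, s) = \<i> * (\<beta> k * Jmat p * adj (\<beta> l)) $$ (i, j)"
    using rs k l by (simp add: Bmat_form_block_index[OF \<beta>] del: index_mult_mat(1))
  moreover have "(AB - adj AB) $$ (r, s) = AB $$ (k * p + i, l * p + j) - cnj (AB $$ (l * p + j, k * p + i))"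
    using rs k l by simp
  moreover have "(\<beta> k * Jmat p * adj (\<beta> k)) $$ (i, j) = (if i = j then 1 else 0)"
    using k l bc_index[of k i j] by simp
  ultimately show "(AB - adj AB) $$ (r, s) = (\<i> \<cdot>\<^sub>m BJB) $$ (r, s)"
    using k l herm by (auto simp: AB_block_index simp del: index_mult_mat(1))
qed auto

text \<open>In block column l, A sums the coefficients of \<open>t l\<close> of order below k and
  adds half of the k-th, all times \<i>. By \<open>t_intertwining_nth\<close> the sum is the
  contribution of the later \<open>t l'\<close>, weighted by the blocks of \<open>AB\<close> below
  its diagonal; the half is its diagonal block.\<close>

lemma Amat_T: "Amat p N * T = T * AB"
proof (rule eq_matI)
  fix r s assume "r < dim_row (T * AB)" "s < dim_col (T * AB)"
  hence rs: "r < Suc N * p" "s < Suc N * p" by auto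
  obtain l j where l: "l < Suc N" "j < p" "s = l * p + j" using rs(2) by (rule block_indexE)
  obtain k i where k: "k < Suc N" "i < p" "r = k * p + i" using rs(1) by (rule block_indexE)
  let ?x = "\<lambda>q. fps_nth (t l $$ (i, j)) q"
  have "(Amat p N * T) $$ (r, s) = (\<Sum>u<Suc N * p. Amat p N $$ (r, u) * T $$ (u, s))"
    using rs by (subst index_mult_sum) auto
  also have "\<dots> = (\<Sum>k'<Suc N. \<Sum>i'<p. Amat p N $$ (r, k' * p + i') * T $$ (k' * p + i', s))"
    by (rule sum_blocks)
  also have "\<dots> = (\<Sum>k'<Suc N. (if k < k' then 0 else if k' = k then \<i> / 2 else \<i>) * ?x k')"
  proof (intro sum.cong refl)
    fix k' assume k': "k' \<in> {..<Suc N}"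
    have "(\<Sum>i'<p. Amat p N $$ (r, k' * p + i') * T $$ (k' * p + i', s)) =
       (\<Sum>i'<p. if i' = i then (if k < k' then 0 else if k' = k then \<i> / 2 else \<i>) * ?x k' else 0)"
      using k k' l by (intro sum.cong refl) (simp add: Amat_block_index T_block_index)
    thus "(\<Sum>i'<p. Amat p N $$ (r, k' * p + i') * T $$ (k' * p + i', s)) =
       (if k < k' then 0 else if k' = k then \<i> / 2 else \<i>) * ?x k'"
      using k by simp
  qed
  also have "\<dots> = (\<Sum>k'\<in>{..<k} \<union> {k}. (if k < k' then 0 else if k' = k then \<i> / 2 else \<i>) * ?x k')"
    using k by (intro sum.mono_neutral_right) auto
  also have "\<dots> = \<i> * (\<Sum>k'<k. ?x k') + \<i> / 2 * ?x k"
    by (simp add: sum_distrib_left)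
  also have "(\<Sum>k'<k. ?x k') =
     (\<Sum>l' = Suc l..N. fps_nth ((t l' * const_mat (\<beta> l' * Jmat p * adj (\<beta> l))) $$ (i, j)) k)"
    by (rule t_intertwining_nth[symmetric]) (use k l in auto)
  also have "\<i> * \<dots> = (\<Sum>l' = Suc l..N. \<Sum>j'<p. fps_nth (t l' $$ (i, j')) k * AB $$ (l' * p + j', s))"
    unfolding sum_distrib_left
  proof (intro sum.cong refl)
    fix l' assume l': "l' \<in> {Suc l..N}"
    have "\<i> * fps_nth ((t l' * const_mat (\<beta> l' * Jmat p * adj (\<beta> l))) $$ (i, j)) k =
       (\<Sum>j'<p. fps_nth (t l' $$ (i, j')) k * (\<i> * (\<beta> l' * Jmat p * adj (\<beta> l)) $$ (j', j)))"
      using k l l' by (subst t_mult_const_nth)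
        (auto simp: sum_distrib_left mult_ac simp del: index_mult_mat(1))
    also have "\<dots> = (\<Sum>j'<p. fps_nth (t l' $$ (i, j')) k * AB $$ (l' * p + j', s))"
      using k l l' by (intro sum.cong refl) (simp add: AB_block_index del: index_mult_mat(1))
    finally show "\<i> * fps_nth ((t l' * const_mat (\<beta> l' * Jmat p * adj (\<beta> l))) $$ (i, j)) k =
       (\<Sum>j'<p. fps_nth (t l' $$ (i, j')) k * AB $$ (l' * p + j', s))" .
  qed
  also have "\<i> / 2 * ?x k = (\<Sum>j'<p. fps_nth (t l $$ (i, j')) k * AB $$ (l * p + j', s))"
  proof -
    have "(\<Sum>j'<p. fps_nth (t l $$ (i, j')) k * AB $$ (l * p + j', s)) =
       (\<Sum>j'<p. if j' = j then \<i> / 2 * ?x k else 0)"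
      using l by (intro sum.cong refl) (simp add: AB_block_index del: index_mult_mat(1))
    thus ?thesis using l by simp
  qed
  also have "(\<Sum>l' = Suc l..N. \<Sum>j'<p. fps_nth (t l' $$ (i, j')) k * AB $$ (l' * p + j', s)) +
      (\<Sum>j'<p. fps_nth (t l $$ (i, j')) k * AB $$ (l * p + j', s)) =
      (\<Sum>l' \<in> {Suc l..N} \<union> {l}. \<Sum>j'<p. fps_nth (t l' $$ (i, j')) k * AB $$ (l' * p + j', s))"
    by (subst sum.union_disjoint) auto
  also have "\<dots> = (\<Sum>l'\<le>N. \<Sum>j'<p. fps_nth (t l' $$ (i, j')) k * AB $$ (l' * p + j', s))"
  proof (rule sum.mono_neutral_left)
    show "\<forall>l'\<in>{..N} - ({Suc l..N} \<union> {l}).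
        (\<Sum>j'<p. fps_nth (t l' $$ (i, j')) k * AB $$ (l' * p + j', s)) = 0"
      using l by (auto intro!: sum.neutral simp: AB_block_index simp del: index_mult_mat(1))
  qed (use l in auto)
  also have "\<dots> = (\<Sum>u<Suc N * p. T $$ (r, u) * AB $$ (u, s))"
    unfolding k(3) by (rule T_row_sum[symmetric]) (use k in auto)
  also have "\<dots> = (T * AB) $$ (r, s)"
    using rs by (subst index_mult_sum) auto
  finally show "(Amat p N * T) $$ (r, s) = (T * AB) $$ (r, s)" .
qed auto

lemma PiMat_dims [simp]: "dim_row (PiMat p N \<alpha>) = Suc N * p" "dim_col (PiMat p N \<alpha>) = 2 * p"
  by (simp_all add: PiMat_def)

lemma T_adj_T_solves:
  "Amat p N * (T * adj T) - (T * adj T) * adj (Amat p N) =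
     \<i> \<cdot>\<^sub>m (PiMat p N \<alpha> * Jmat p * adj (PiMat p N \<alpha>))"
proof -
  have "(T * adj T) * adj (Amat p N) = T * adj (Amat p N * T)"
    by (simp add: mat_ring_simps)
  also have "\<dots> = T * adj AB * adj T"
    by (simp add: Amat_T mat_ring_simps)
  finally have r: "(T * adj T) * adj (Amat p N) = T * adj AB * adj T" .
  have "Amat p N * (T * adj T) = (Amat p N * T) * adj T"
    by (simp add: mat_mult_assoc)
  also have "\<dots> = T * AB * adj T"
    by (simp only: Amat_T)
  finally have "Amat p N * (T * adj T) - (T * adj T) * adj (Amat p N) = T * (AB - adj AB) * adj T"
    unfolding r by (simp add: mat_ring_simps)
  also have "\<dots> = \<i> \<cdot>\<^sub>m ((T * Bmat p N \<beta>) * Jmat p * adj (T * Bmat p N \<beta>))"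
    unfolding AB_minus_adj by (simp add: mat_ring_simps)
  finally show ?thesis
    by (simp only: T_Bmat)
qed

lemma sylvester_solution:
  assumes S: "S \<in> carrier_mat (Suc N * p) (Suc N * p)"
    and eq: "Amat p N * S - S * adj (Amat p N) = \<i> \<cdot>\<^sub>m (PiMat p N \<alpha> * Jmat p * adj (PiMat p N \<alpha>))"
  shows "S = T * adj T"
proof (rule sylvester_lower_triangular_unique)
  show "Amat p N * S - S * adj (Amat p N) = Amat p N * (T * adj T) - T * adj T * adj (Amat p N)"
    unfolding T_adj_T_solves by (rule eq)
  show "\<i> / 2 \<noteq> cnj (\<i> / 2)" by (simp add: complex_eq_iff)
  show "Amat p N $$ (r, r) = \<i> / 2" if "r < Suc N * p" for r
    using that by (rule Amat_diag)
qed (use S in \<open>auto intro: Amat_lower_triangular simp del: mult_Suc\<close>)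

lemma minv_T_adj_T:
  "minv (T * adj T) = adj (minv T) * minv T" "adj T * adj (minv T) = 1\<^sub>m (Suc N * p)"
  "minv T * T = 1\<^sub>m (Suc N * p)" "dim_row (minv T) = Suc N * p" "dim_col (minv T) = Suc N * p"
proof -
  have T: "T \<in> carrier_mat (Suc N * p) (Suc N * p)" by (simp add: T_def)
  note I = minv_inverse[OF T det_T]
  show dims: "dim_row (minv T) = Suc N * p" "dim_col (minv T) = Suc N * p"
    using I(3) by auto
  show "minv T * T = 1\<^sub>m (Suc N * p)" by (rule I)
  have "adj (minv T * T) = 1\<^sub>m (Suc N * p)" by (simp only: I adj_one)
  thus a: "adj T * adj (minv T) = 1\<^sub>m (Suc N * p)"
    by (simp only: adj_mult T_dims dims)
  have "T * adj T * (adj (minv T) * minv T) = T * (adj T * adj (minv T)) * minv T"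
    by (simp add: mat_mult_assoc dims del: mult_Suc)
  also have "\<dots> = 1\<^sub>m (Suc N * p)"
    unfolding a using T by (simp add: I del: mult_Suc)
  finally show "minv (T * adj T) = adj (minv T) * minv T"
    by (intro minv_unique) (use dims in auto)
qed

lemma pos_def_T_adj_T: "pos_def (Suc N * p) (T * adj T)"
  unfolding pos_def_iff_ip
proof (intro conjI ballI impI)
  show "T * adj T \<in> carrier_mat (Suc N * p) (Suc N * p)"
    by (intro carrier_matI) simp_all
  show "adj (T * adj T) = T * adj T"
    by (simp add: adj_mult)
  fix v :: "complex vec" assume v: "v \<in> carrier_vec (Suc N * p)" "v \<noteq> 0\<^sub>v (Suc N * p)"
  have dv [simp]: "dim_vec v = Suc N * p" using v by auto
  have eq: "ip v (T * adj T *\<^sub>v v) = ip (adj T *\<^sub>v v) (adj T *\<^sub>v v)"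
    by (simp add: mat_vec_assoc ip_adj del: mult_Suc)
  show "0 < Re (ip v (T * adj T *\<^sub>v v))"
  proof (rule ccontr)
    assume "\<not> ?thesis"
    hence "adj T *\<^sub>v v = 0\<^sub>v (Suc N * p)"
      unfolding eq by (intro Re_ip_self_zeroD) auto
    have "adj (minv T) * adj T = 1\<^sub>m (Suc N * p)"
      by (rule mat_mult_left_right_inverse[OF _ _ minv_T_adj_T(2)])
         (intro carrier_matI; simp add: minv_T_adj_T del: mult_Suc)+
    hence "v = adj (minv T) * adj T *\<^sub>v v"
      using v by (simp del: mult_Suc)
    also have "\<dots> = adj (minv T) *\<^sub>v (adj T *\<^sub>v v)"
      by (rule mat_vec_assoc) (simp_all add: minv_T_adj_T del: mult_Suc)
    also have "\<dots> = 0\<^sub>v (Suc N * p)"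
      unfolding \<open>adj T *\<^sub>v v = 0\<^sub>v (Suc N * p)\<close>
      by (intro eq_vecI) (auto simp: scalar_prod_def minv_T_adj_T simp del: mult_Suc)
    finally show False using v by simp
  qed
qed

lemma PiMat_gram: "adj (PiMat p N \<alpha>) * minv (T * adj T) * PiMat p N \<alpha> = adj (Bmat p N \<beta>) * Bmat p N \<beta>"
proof -
  note d = minv_T_adj_T(4,5)
  have "adj (T * Bmat p N \<beta>) * (adj (minv T) * minv T) * (T * Bmat p N \<beta>) =
     adj (Bmat p N \<beta>) * (adj T * adj (minv T)) * ((minv T * T) * Bmat p N \<beta>)"
    by (simp add: mat_mult_assoc adj_mult d del: mult_Suc)
  also have "\<dots> = adj (Bmat p N \<beta>) * Bmat p N \<beta>"
    unfolding minv_T_adj_T(2,3) by (simp add: mat_one_mult del: mult_Suc)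
  finally show ?thesis
    by (simp only: minv_T_adj_T(1) T_Bmat)
qed

end

section \<open>Power series expansions of matrix functions\<close>

text \<open>The dimensions are fixed at every z, not only near 0, so that products and determinants
  can be unfolded into entries without restricting z.\<close>

definition mat_has_fps ::
  "nat \<Rightarrow> nat \<Rightarrow> (complex \<Rightarrow> complex mat) \<Rightarrow> complex fps mat \<Rightarrow> bool" where
  "mat_has_fps n m f H \<longleftrightarrow> H \<in> carrier_mat n m \<and> (\<forall>z. f z \<in> carrier_mat n m) \<and>
     (\<forall>i<n. \<forall>j<m. (\<lambda>z. f z $$ (i, j)) has_fps_expansion H $$ (i, j))"

lemma mat_has_fpsI:
  assumes "H \<in> carrier_mat n m" "\<And>z. f z \<in> carrier_mat n m"
    "\<And>i j. i < n \<Longrightarrow> j < m \<Longrightarrow> (\<lambda>z. f z $$ (i, j)) has_fps_expansion H $$ (i, j)"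
  shows "mat_has_fps n m f H"
  using assms by (simp add: mat_has_fps_def)

lemma mat_has_fpsD:
  assumes "mat_has_fps n m f H"
  shows "dim_row H = n" "dim_col H = m" "dim_row (f z) = n" "dim_col (f z) = m"
    "i < n \<Longrightarrow> j < m \<Longrightarrow> (\<lambda>z. f z $$ (i, j)) has_fps_expansion H $$ (i, j)"
  using assms unfolding mat_has_fps_def by auto

lemma mat_has_fps_const: "A \<in> carrier_mat n m \<Longrightarrow> mat_has_fps n m (\<lambda>_. A) (const_mat A)"
  by (intro mat_has_fpsI) auto

lemma mat_has_fps_mult:
  assumes f: "mat_has_fps n m f A" and g: "mat_has_fps m q g B"
  shows "mat_has_fps n q (\<lambda>z. f z * g z) (A * B)"
proof (intro mat_has_fpsI carrier_matI)
  note d = mat_has_fpsD[OF f] mat_has_fpsD[OF g]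
  fix i j assume ij: "i < n" "j < q"
  have "(\<lambda>z. \<Sum>s<m. f z $$ (i, s) * g z $$ (s, j)) has_fps_expansion (\<Sum>s<m. A $$ (i, s) * B $$ (s, j))"
    by (intro fps_expansion_intros d(5) d(10)) (use ij in auto)
  thus "(\<lambda>z. (f z * g z) $$ (i, j)) has_fps_expansion (A * B) $$ (i, j)"
    using ij by (simp add: index_mult_sum d(1-4) d(6-9) del: index_mult_mat(1))
qed (simp_all add: mat_has_fpsD[OF f] mat_has_fpsD[OF g])

lemma mat_has_fps_smult:
  assumes c: "c has_fps_expansion C" and f: "mat_has_fps n m f A"
  shows "mat_has_fps n m (\<lambda>z. c z \<cdot>\<^sub>m f z) (C \<cdot>\<^sub>m A)"
proof (intro mat_has_fpsI carrier_matI)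
  note d = mat_has_fpsD[OF f]
  fix i j assume ij: "i < n" "j < m"
  show "(\<lambda>z. (c z \<cdot>\<^sub>m f z) $$ (i, j)) has_fps_expansion (C \<cdot>\<^sub>m A) $$ (i, j)"
    using has_fps_expansion_mult[OF c d(5)[OF ij]] ij by (simp add: d(1-4))
qed (simp_all add: mat_has_fpsD[OF f])

lemma det_has_fps:
  assumes f: "mat_has_fps n n f A"
  shows "(\<lambda>z. det (f z)) has_fps_expansion det A"
proof -
  note d = mat_has_fpsD[OF f]
  have sgn: "(\<lambda>z. signof \<pi>) has_fps_expansion signof \<pi>" for \<pi> :: "nat \<Rightarrow> nat"
    using has_fps_expansion_minus[OF has_fps_expansion_1] by (auto simp: sign_def)
  have "(\<lambda>z. \<Sum>\<pi> | \<pi> permutes {0..<n}. signof \<pi> * (\<Prod>i = 0..<n. f z $$ (i, \<pi> i))) has_fps_expansion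
      (\<Sum>\<pi> | \<pi> permutes {0..<n}. signof \<pi> * (\<Prod>i = 0..<n. A $$ (i, \<pi> i)))"
    by (intro fps_expansion_intros sgn d(5)) (auto dest: permutes_in_image)
  thus ?thesis
    using f by (simp add: det_def'[of _ n] mat_has_fps_def)
qed

lemma adj_mat_has_fps:
  assumes f: "mat_has_fps n n f A"
  shows "mat_has_fps n n (\<lambda>z. adj_mat (f z)) (adj_mat A)"
proof (intro mat_has_fpsI carrier_matI)
  note d = mat_has_fpsD[OF f]
  fix i j assume ij: "i < n" "j < n"
  have "mat_has_fps (n - 1) (n - 1) (\<lambda>z. mat_delete (f z) j i) (mat_delete A j i)"
  proof (intro mat_has_fpsI carrier_matI)
    fix a b assume ab: "a < n - 1" "b < n - 1"
    show "(\<lambda>z. mat_delete (f z) j i $$ (a, b)) has_fps_expansion mat_delete A j i $$ (a, b)"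
      using ab ij by (simp add: mat_delete_def d(1-4)) (auto intro!: d(5))
  qed (simp_all add: d(1-4))
  hence "(\<lambda>z. (- 1) ^ (j + i) * det (mat_delete (f z) j i)) has_fps_expansion
      (- 1) ^ (j + i) * det (mat_delete A j i)"
    by (intro fps_expansion_intros det_has_fps) auto
  thus "(\<lambda>z. adj_mat (f z) $$ (i, j)) has_fps_expansion adj_mat A $$ (i, j)"
    using ij by (simp add: adj_mat_def cofactor_def d(1-4))
qed (simp_all add: adj_mat_def mat_has_fpsD[OF f])

text \<open>\<open>minv\<close> is computed by Gauss-Jordan elimination, which says nothing about
  dependence on parameters. In the adjugate formula the entries are polynomials divided by the
  determinant, so they expand in power series.\<close>

lemma minv_eq_adj_mat:
  assumes M: "M \<in> carrier_mat n n" and d: "det M \<noteq> 0"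
  shows "minv M = inverse (det M) \<cdot>\<^sub>m adj_mat M"
proof (rule minv_unique[OF M])
  show "M * (inverse (det M) \<cdot>\<^sub>m adj_mat M) = 1\<^sub>m n"
    using M adj_mat(1)[OF M] d
    by (simp add: mat_mult_smult adj_mat(2)[OF M]) (auto intro!: eq_matI)
qed (use adj_mat(1)[OF M] in auto)

section \<open>Block columns and the factorization of the transformed solution\<close>

definition upper_half :: "nat \<Rightarrow> 'a mat \<Rightarrow> 'a mat" where
  "upper_half p X = mat p (dim_col X) (\<lambda>(i, j). X $$ (i, j))"

definition lower_half :: "nat \<Rightarrow> 'a mat \<Rightarrow> 'a mat" where
  "lower_half p X = mat p (dim_col X) (\<lambda>(i, j). X $$ (p + i, j))"

definition stack :: "nat \<Rightarrow> 'a mat \<Rightarrow> 'a mat \<Rightarrow> 'a mat" where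
  "stack p R Q = mat (2 * p) (dim_col R) (\<lambda>(i, j). if i < p then R $$ (i, j) else Q $$ (i - p, j))"

lemma half_dims [simp]:
  "dim_row (upper_half p X) = p" "dim_col (upper_half p X) = dim_col X"
  "dim_row (lower_half p X) = p" "dim_col (lower_half p X) = dim_col X"
  "dim_row (stack p R Q) = 2 * p" "dim_col (stack p R Q) = dim_col R"
  by (simp_all add: upper_half_def lower_half_def stack_def)

lemma half_mult:
  fixes A B :: "'a::comm_semiring_0 mat"
  assumes "dim_row A = 2 * p" "dim_col A = dim_row B"
  shows "upper_half p (A * B) = upper_half p A * B" "lower_half p (A * B) = lower_half p A * B"
  using assms by (auto intro!: eq_matI simp: upper_half_def lower_half_def scalar_prod_def)

lemma half_has_fps:
  assumes f: "mat_has_fps (2 * p) m f A"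
  shows "mat_has_fps p m (\<lambda>z. upper_half p (f z)) (upper_half p A)"
    "mat_has_fps p m (\<lambda>z. lower_half p (f z)) (lower_half p A)"
  by (intro mat_has_fpsI carrier_matI;
      use mat_has_fpsD[OF f] in \<open>simp add: upper_half_def lower_half_def\<close>)+

lemma sum_two_halves:
  fixes f :: "nat \<Rightarrow> 'a::comm_monoid_add"
  shows "(\<Sum>s<2 * p. f s) = (\<Sum>s<p. f s) + (\<Sum>s<p. f (p + s))"
  using sum_blocks[of f "Suc (Suc 0)" p] by (simp add: mult_2)

text \<open>The product of n consecutive factors beginning with \<open>F k\<close>, applied to
  \<open>Y\<close>. It is generic in the ring because it is used for complex matrices at a fixed z
  and for matrices of power series.\<close>

primrec chain :: "(nat \<Rightarrow> 'a::comm_semiring_1 mat) \<Rightarrow> 'a mat \<Rightarrow> nat \<Rightarrow> nat \<Rightarrow> 'a mat" where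
  "chain F Y 0 k = Y"
| "chain F Y (Suc n) k = F k * chain F Y n (Suc k)"

text \<open>The recursion for W produces new factors at the right end, next to \<open>Y\<close>,
  whereas \<open>chain\<close> unfolds at the left.\<close>

lemma chain_snoc: "chain F (F (k + n) * Y) n k = chain F Y (Suc n) k"
proof (induction n arbitrary: k)
  case (Suc n)
  show ?case using Suc[of "Suc k"] by simp
qed simp

lemma chain_dim:
  assumes "\<And>l. l < k + n \<Longrightarrow> dim_row (F l) = m \<and> dim_col (F l) = m" "dim_row Y = m"
  shows "dim_row (chain F Y n k) = m \<and> dim_col (chain F Y n k) = dim_col Y"
  using assms by (induction n arbitrary: k) simp_all

lemma chain_smult:
  assumes "\<And>l. l < k + n \<Longrightarrow> dim_row (F l) = m \<and> dim_col (F l) = m" "dim_row Y = m"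
  shows "chain F (s \<cdot>\<^sub>m Y) n k = s \<cdot>\<^sub>m chain F Y n k"
  using assms(1)
proof (induction n arbitrary: k)
  case (Suc n)
  have "dim_row (chain F Y n (Suc k)) = m"
    using chain_dim[of "Suc k" n F m Y] assms(2) Suc.prems by simp
  thus ?case
    using Suc.IH[of "Suc k"] Suc.prems[of k] Suc.prems by (simp add: mat_mult_smult)
qed simp

lemma chain_has_fps:
  assumes F: "\<And>l. l < k + n \<Longrightarrow> mat_has_fps m m (F l) (A l)" and Y: "mat_has_fps m q Y B"
  shows "mat_has_fps m q (\<lambda>z. chain (\<lambda>l. F l z) (Y z) n k) (chain A B n k)"
  using F
proof (induction n arbitrary: k)
  case 0
  show ?case using Y by simp
next
  case (Suc n)
  show ?case
    unfolding chain.simps by (rule mat_has_fps_mult[OF Suc.prems Suc.IH]) (use Suc.prems in auto)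
qed

text \<open>The two combinations in \<phi> are the halves of the single product of the transformed
  solution with the column of R over Q.\<close>

lemma calW_mult_stack:
  assumes R: "R \<in> carrier_mat p p" and Q: "Q \<in> carrier_mat p p"
    and W: "dim_row (calW p N \<beta> z) = 2 * p" "dim_col (calW p N \<beta> z) = 2 * p"
  shows "W11 p N \<beta> z * R + W12 p N \<beta> z * Q = upper_half p (calW p N \<beta> z * stack p R Q)"
    "W21 p N \<beta> z * R + W22 p N \<beta> z * Q = lower_half p (calW p N \<beta> z * stack p R Q)"
  using R Q W
  by (auto intro!: eq_matI simp: W11_def W12_def W21_def W22_def split_block_def Let_def
      upper_half_def lower_half_def stack_def scalar_prod_def atLeast0LessThan sum_two_halves
      add.commute)

definition Pmat :: "nat \<Rightarrow> complex mat \<Rightarrow> complex mat" where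
  "Pmat p b = adj b * (b * Jmat p)"

definition Fmat :: "nat \<Rightarrow> (nat \<Rightarrow> complex mat) \<Rightarrow> nat \<Rightarrow> complex \<Rightarrow> complex mat" where
  "Fmat p \<beta> k z = 1\<^sub>m (2 * p) + (z - 1) \<cdot>\<^sub>m Pmat p (\<beta> k)"

lemma Pmat_dims [simp]:
  "dim_col b = 2 * p \<Longrightarrow> dim_row (Pmat p b) = 2 * p" "dim_col (Pmat p b) = 2 * p"
  by (simp_all add: Pmat_def)

lemma Fmat_dims [simp]:
  "dim_col (\<beta> k) = 2 * p \<Longrightarrow> dim_row (Fmat p \<beta> k z) = 2 * p" "dim_col (Fmat p \<beta> k z) = 2 * p"
  by (simp_all add: Fmat_def)

lemma Cmat_dims [simp]: "dim_row (Cmat p \<beta> k) = 2 * p" "dim_col (Cmat p \<beta> k) = 2 * p"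
  by (simp_all add: Cmat_def)

lemma Wmat_dims [simp]: "dim_row (Wmat p \<beta> k z) = 2 * p" "dim_col (Wmat p \<beta> k z) = 2 * p"
  by (induction k) simp_all

lemma calW_dims [simp]: "dim_row (calW p N \<beta> z) = 2 * p" "dim_col (calW p N \<beta> z) = 2 * p"
  by (simp_all add: calW_def)

lemma Kmat_Cmat_jmat:
  assumes \<beta>: "\<beta> k \<in> carrier_mat p (2 * p)"
  shows "Kmat p * (Cmat p \<beta> k * jmat p) = (2 \<cdot>\<^sub>m Pmat p (\<beta> k) - 1\<^sub>m (2 * p)) * Kmat p"
proof -
  have d [simp]: "dim_row (\<beta> k) = p" "dim_col (\<beta> k) = 2 * p" using \<beta> by auto
  have KK: "Kmat p * (adj (Kmat p) * X) = X" if "dim_row X = 2 * p" for X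
  proof -
    have "Kmat p * (adj (Kmat p) * X) = Kmat p * adj (Kmat p) * X"
      using that by (simp add: mat_mult_assoc del: Kmat_adj)
    thus ?thesis using that by (simp add: mat_one_mult)
  qed
  show ?thesis
    unfolding Cmat_def Pmat_def by (simp add: mat_ring_simps KK Kmat_jmat)
qed

text \<open>The adjoint reverses the product and, \<open>Cmat p \<beta> k\<close> being Hermitian,
  puts the new factor on the right; the conjugated argument makes the coefficient analytic in
  z.\<close>

lemma adj_Wmat_Suc:
  assumes \<beta>: "\<beta> k \<in> carrier_mat p (2 * p)" and \<beta>J: "\<beta> k * Jmat p * adj (\<beta> k) = 1\<^sub>m p"
  shows "adj (Wmat p \<beta> (Suc k) (cnj z)) =
    adj (Wmat p \<beta> k (cnj z)) * (1\<^sub>m (2 * p) + (\<i> / z) \<cdot>\<^sub>m (Cmat p \<beta> k * jmat p))"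
proof -
  have "adj (Wmat p \<beta> (Suc k) (cnj z)) = adj (Wmat p \<beta> k (cnj z)) -
      (- (\<i> / z)) \<cdot>\<^sub>m (adj (Wmat p \<beta> k (cnj z)) * (Cmat p \<beta> k * jmat p))"
    using Cmat_properties(1)[of \<beta> k p, OF \<beta> \<beta>J] by (simp add: mat_ring_simps)
  also have "\<dots> = adj (Wmat p \<beta> k (cnj z)) +
      (\<i> / z) \<cdot>\<^sub>m (adj (Wmat p \<beta> k (cnj z)) * (Cmat p \<beta> k * jmat p))"
    by (rule eq_matI) (simp_all del: index_mult_mat(1))
  finally show ?thesis
    by (simp add: mat_ring_simps)
qed

text \<open>Sends 0 to -\<i>, the point where R and Q are analytic; z = 1 and z = -1 correspond to
  \<lambda> infinite and \<lambda> = 0.\<close>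

abbreviation cayley :: "complex \<Rightarrow> complex" where
  "cayley z \<equiv> \<i> * (z + 1) / (z - 1)"

text \<open>Conjugation by K turns \<open>Cmat p \<beta> k * jmat p\<close> into 2P - 1, and
  \<i>/\<lambda> = (z - 1)/(z + 1); hence 1 + (\<i>/\<lambda>)(2P - 1) is 2/(z + 1) times 1 + (z -
  1)P.\<close>

lemma Kmat_step:
  assumes \<beta>: "\<beta> k \<in> carrier_mat p (2 * p)" and z: "z \<noteq> 1" "z \<noteq> - 1"
  shows "Kmat p * (1\<^sub>m (2 * p) + (\<i> / cayley z) \<cdot>\<^sub>m (Cmat p \<beta> k * jmat p)) =
    (2 / (z + 1)) \<cdot>\<^sub>m (Fmat p \<beta> k z * Kmat p)"
proof -
  have d [simp]: "dim_row (\<beta> k) = p" "dim_col (\<beta> k) = 2 * p" using \<beta> by auto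
  have z1: "z + 1 \<noteq> 0" "z - 1 \<noteq> 0" using z by (auto simp: eq_neg_iff_add_eq_0)
  have c: "\<i> / cayley z = (z - 1) / (z + 1)"
    unfolding divide_divide_eq_right by (rule mult_divide_mult_cancel_left) simp
  have s: "1 - (z - 1) / (z + 1) = 2 / (z + 1)" using z1 by (simp add: field_simps)
  let ?P = "Pmat p (\<beta> k)"
  have "1\<^sub>m (2 * p) + ((z - 1) / (z + 1)) \<cdot>\<^sub>m (2 \<cdot>\<^sub>m ?P - 1\<^sub>m (2 * p)) = (2 / (z + 1)) \<cdot>\<^sub>m Fmat p \<beta> k z"
  proof (rule eq_matI)
    fix i j assume "i < dim_row ((2 / (z + 1)) \<cdot>\<^sub>m Fmat p \<beta> k z)" "j < dim_col ((2 / (z + 1)) \<cdot>\<^sub>m Fmat p \<beta> k z)"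
    hence ij: "i < 2 * p" "j < 2 * p" by auto
    have "x + (z - 1) / (z + 1) * (2 * y - x) = 2 / (z + 1) * (x + (z - 1) * y)" for x y
      using z1 by (simp add: field_simps)
    thus "(1\<^sub>m (2 * p) + ((z - 1) / (z + 1)) \<cdot>\<^sub>m (2 \<cdot>\<^sub>m ?P - 1\<^sub>m (2 * p))) $$ (i, j) =
       ((2 / (z + 1)) \<cdot>\<^sub>m Fmat p \<beta> k z) $$ (i, j)"
      using ij by (simp add: Fmat_def del: index_one_mat(1))
  qed auto
  hence "(1\<^sub>m (2 * p) + ((z - 1) / (z + 1)) \<cdot>\<^sub>m (2 \<cdot>\<^sub>m ?P - 1\<^sub>m (2 * p))) * Kmat p =
     (2 / (z + 1)) \<cdot>\<^sub>m (Fmat p \<beta> k z * Kmat p)"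
    by (simp only:) (simp add: mat_smult_mult)
  moreover have "Kmat p * (1\<^sub>m (2 * p) + ((z - 1) / (z + 1)) \<cdot>\<^sub>m (Cmat p \<beta> k * jmat p)) =
     Kmat p + ((z - 1) / (z + 1)) \<cdot>\<^sub>m (Kmat p * (Cmat p \<beta> k * jmat p))"
    by (simp add: mat_mult_add mat_mult_smult mat_one_mult)
  moreover have "Kmat p + ((z - 1) / (z + 1)) \<cdot>\<^sub>m ((2 \<cdot>\<^sub>m ?P - 1\<^sub>m (2 * p)) * Kmat p) =
     (1\<^sub>m (2 * p) + ((z - 1) / (z + 1)) \<cdot>\<^sub>m (2 \<cdot>\<^sub>m ?P - 1\<^sub>m (2 * p))) * Kmat p"
    by (simp add: mat_add_mult mat_smult_mult mat_one_mult)
  ultimately show ?thesis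
    unfolding c Kmat_Cmat_jmat[of \<beta> k p, OF \<beta>] by simp
qed

text \<open>The right factor \<open>Z\<close> stays arbitrary because the induction step absorbs the
  newest factor into it before K is moved past that factor.\<close>

lemma Kmat_adj_Wmat:
  assumes \<beta>: "\<And>k. k < n \<Longrightarrow> \<beta> k \<in> carrier_mat p (2 * p)"
    and \<beta>J: "\<And>k. k < n \<Longrightarrow> \<beta> k * Jmat p * adj (\<beta> k) = 1\<^sub>m p"
    and z: "z \<noteq> 1" "z \<noteq> - 1" and Z: "dim_row Z = 2 * p"
  shows "Kmat p * adj (Wmat p \<beta> n (cnj (cayley z))) * Z =
    (2 / (z + 1)) ^ n \<cdot>\<^sub>m chain (\<lambda>k. Fmat p \<beta> k z) (Kmat p * Z) n 0"
  using \<beta> \<beta>J Z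
proof (induction n arbitrary: Z)
  case 0
  thus ?case by (auto simp: mat_one_mult intro!: eq_matI)
next
  case (Suc n)
  let ?s = "2 / (z + 1)" and ?F = "\<lambda>k. Fmat p \<beta> k z"
  let ?H = "1\<^sub>m (2 * p) + (\<i> / cayley z) \<cdot>\<^sub>m (Cmat p \<beta> n * jmat p)"
  have \<beta>n: "\<beta> n \<in> carrier_mat p (2 * p)" "\<beta> n * Jmat p * adj (\<beta> n) = 1\<^sub>m p" using Suc.prems by auto
  have d [simp]: "dim_col (\<beta> k) = 2 * p" if "k < Suc n" for k
    using Suc.prems(1)[OF that] by auto
  have Zd [simp]: "dim_row Z = 2 * p" by (rule Suc.prems)
  have "Kmat p * adj (Wmat p \<beta> (Suc n) (cnj (cayley z))) * Z =
     Kmat p * adj (Wmat p \<beta> n (cnj (cayley z))) * (?H * Z)"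
    unfolding adj_Wmat_Suc[of \<beta> n p, OF \<beta>n] by (simp add: mat_mult_assoc)
  also have "\<dots> = ?s ^ n \<cdot>\<^sub>m chain ?F (Kmat p * (?H * Z)) n 0"
    using Suc.prems by (intro Suc.IH) auto
  also have "Kmat p * (?H * Z) = (Kmat p * ?H) * Z"
    by (simp add: mat_mult_assoc)
  also have "\<dots> = ?s \<cdot>\<^sub>m (Fmat p \<beta> n z * (Kmat p * Z))"
    unfolding Kmat_step[of \<beta> n p, OF \<beta>n(1) z] by (simp add: mat_mult_assoc mat_smult_mult)
  also have "chain ?F \<dots> n 0 = ?s \<cdot>\<^sub>m chain ?F (Fmat p \<beta> n z * (Kmat p * Z)) n 0"
    by (rule chain_smult[where m = "2 * p"]) auto
  also have "chain ?F (Fmat p \<beta> n z * (Kmat p * Z)) n 0 = chain ?F (Kmat p * Z) (Suc n) 0"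
    using chain_snoc[of ?F 0 n "Kmat p * Z"] by simp
  also have "?s ^ n \<cdot>\<^sub>m (?s \<cdot>\<^sub>m chain ?F (Kmat p * Z) (Suc n) 0) = ?s ^ Suc n \<cdot>\<^sub>m chain ?F (Kmat p * Z) (Suc n) 0"
    by (rule eq_matI) (auto simp del: chain.simps)
  finally show ?case .
qed

section \<open>Consequences for a chain and its truncations\<close>

lemma (in J_chain) unique_solution:
  "\<exists>!S. S \<in> carrier_mat (Suc N * p) (Suc N * p) \<and>
     Amat p N * S - S * adj (Amat p N) = \<i> \<cdot>\<^sub>m (PiMat p N \<alpha> * Jmat p * adj (PiMat p N \<alpha>))"
proof (rule ex1I[of _ "T * adj T"])
  show "T * adj T \<in> carrier_mat (Suc N * p) (Suc N * p) \<and>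
     Amat p N * (T * adj T) - (T * adj T) * adj (Amat p N) =
       \<i> \<cdot>\<^sub>m (PiMat p N \<alpha> * Jmat p * adj (PiMat p N \<alpha>))"
    using T_adj_T_solves by (auto simp del: mult_Suc)
qed (use sylvester_solution in blast)

lemma (in J_chain) solution_properties:
  assumes "S \<in> carrier_mat (Suc N * p) (Suc N * p)"
    and "Amat p N * S - S * adj (Amat p N) = \<i> \<cdot>\<^sub>m (PiMat p N \<alpha> * Jmat p * adj (PiMat p N \<alpha>))"
  shows "pos_def (Suc N * p) S"
    "adj (PiMat p N \<alpha>) * minv S * PiMat p N \<alpha> = adj (Bmat p N \<beta>) * Bmat p N \<beta>"
  unfolding sylvester_solution[OF assms] by (rule pos_def_T_adj_T PiMat_gram)+

text \<open>\<open>V (Suc M)\<close> becomes the end of the shorter chain, while \<open>g0\<close>,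
  and with it G and \<alpha>, stays the same. Cutting the chain rather than the original problem
  avoids finding parameters R and Q for each M.\<close>

lemma (in J_chain) truncate:
  assumes "M \<le> N"
  shows "J_chain p M \<beta> V g0 E E' \<alpha>"
  using assms bc V_step g0_V E E_V E' g0_E' g0 V g0_left g0_right b c
  by unfold_locales auto

lemma (in J_chain) det_step:
  assumes k: "k < N"
  shows "det (\<beta> k * Jmat p * adj (\<beta> (Suc k))) \<noteq> 0"
proof -
  let ?M = "\<beta> (Suc k) * Jmat p * adj (\<beta> k)"
  have M: "?M \<in> carrier_mat p p"
    using k by (intro carrier_matI) auto
  note I = minv_inverse[OF M det_b_c[OF k]]
  have adjM: "adj ?M = \<beta> k * Jmat p * adj (\<beta> (Suc k))"
    using k by (simp add: mat_ring_simps)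
  have "adj (minv ?M) * adj ?M = adj (?M * minv ?M)"
    using M I(3) by (subst adj_mult) auto
  hence "adj (minv ?M) * adj ?M = 1\<^sub>m p" by (simp only: I adj_one)
  moreover have "det (adj (minv ?M) * adj ?M) = det (adj (minv ?M)) * det (adj ?M)"
    by (rule det_mult[OF carrier_adj[OF I(3)] carrier_adj[OF M]])
  ultimately have "det (adj ?M) \<noteq> 0" by auto
  thus ?thesis by (simp only: adjM not_False_eq_True)
qed

section \<open>From admissible data to a chain\<close>

lemma Fmat_has_fps:
  assumes "\<beta> k \<in> carrier_mat p (2 * p)"
  shows "mat_has_fps (2 * p) (2 * p) (Fmat p \<beta> k) (proj_factor (2 * p) (Pmat p (\<beta> k)))"
proof -
  have d [simp]: "dim_col (\<beta> k) = 2 * p" using assms by auto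
  show ?thesis
  proof (intro mat_has_fpsI carrier_matI)
    fix i j assume ij: "i < 2 * p" "j < 2 * p"
    have "(\<lambda>z. 1\<^sub>m (2 * p) $$ (i, j) + (z - 1) * Pmat p (\<beta> k) $$ (i, j)) has_fps_expansion
        fps_const (1\<^sub>m (2 * p) $$ (i, j)) + (fps_X - 1) * fps_const (Pmat p (\<beta> k) $$ (i, j))"
      by (intro fps_expansion_intros)
    moreover have "fps_const (1\<^sub>m (2 * p) $$ (i, j)) = (1\<^sub>m (2 * p) $$ (i, j) :: complex fps)"
      using ij by simp
    ultimately show "(\<lambda>z. Fmat p \<beta> k z $$ (i, j)) has_fps_expansion
        proj_factor (2 * p) (Pmat p (\<beta> k)) $$ (i, j)"
      using ij by (simp add: Fmat_def proj_factor_def del: index_one_mat(1))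
  qed auto
qed

lemma cayley_has_fps:
  assumes "mat_analytic_near p R (- \<i>)"
  shows "\<exists>H. mat_has_fps p p (\<lambda>z. R (cayley z)) H"
proof -
  from assms obtain e where R: "\<And>z. R z \<in> carrier_mat p p" and e: "e > 0"
    and an: "\<And>a b. a < p \<Longrightarrow> b < p \<Longrightarrow> (\<lambda>z. R z $$ (a, b)) analytic_on ball (- \<i>) e"
    by (auto simp: mat_analytic_near_def)
  have "(\<lambda>z. R (cayley z) $$ (a, b)) has_fps_expansion fps_expansion (\<lambda>z. R (cayley z) $$ (a, b)) 0"
    if "a < p" "b < p" for a b
  proof (rule analytic_at_imp_has_fps_expansion_0)
    have "(\<lambda>z. R z $$ (a, b)) analytic_on {- \<i>}"
      by (rule analytic_on_subset[OF an[OF that]]) (use e in auto)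
    hence "(\<lambda>z. R z $$ (a, b)) \<circ> cayley analytic_on {0}"
      by (intro analytic_on_compose_gen[where T = "{- \<i>}"] analytic_intros) auto
    thus "(\<lambda>z. R (cayley z) $$ (a, b)) analytic_on {0}"
      by (simp add: o_def)
  qed
  hence "mat_has_fps p p (\<lambda>z. R (cayley z))
      (mat p p (\<lambda>(a, b). fps_expansion (\<lambda>z. R (cayley z) $$ (a, b)) 0))"
    using R by (intro mat_has_fpsI) auto
  thus ?thesis by blast
qed

lemma stack_has_fps:
  assumes R: "mat_has_fps p m R A" and Q: "mat_has_fps p m Q B"
  shows "mat_has_fps (2 * p) m (\<lambda>z. stack p (R z) (Q z)) (stack p A B)"
proof (intro mat_has_fpsI carrier_matI)
  fix i j assume "i < 2 * p" "j < m"
  thus "(\<lambda>z. stack p (R z) (Q z) $$ (i, j)) has_fps_expansion stack p A B $$ (i, j)"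
    using mat_has_fpsD(5)[OF R, of i j] mat_has_fpsD(5)[OF Q, of "i - p" j]
    by (simp add: stack_def mat_has_fpsD(1-4)[OF R] mat_has_fpsD(1-4)[OF Q])
qed (simp_all add: mat_has_fpsD(1-4)[OF R])

lemma mult_self_minus_one: "(a :: complex) * a = - 1 \<Longrightarrow> a * (a * x) = - x"
  by (simp flip: mult.assoc)

text \<open>\<open>V k\<close> is the product of the factors from index k to N with a column
  \<open>Y\<close>, normalized by the inverse of the upper half U of the full product. After this
  normalization the lower half of \<open>V 0\<close> is -\<i>\<phi>.\<close>

lemma admissible_factorization:
  assumes adm: "admissible p N \<beta> R Q"
  obtains V where "\<And>k. k \<le> Suc N \<Longrightarrow> V k \<in> carrier_mat (2 * p) p"
    "\<And>k. k \<le> N \<Longrightarrow> V k = proj_factor (2 * p) (Pmat p (\<beta> k)) * V (Suc k)"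
    "upper_half p (V 0) = 1\<^sub>m p"
    "\<And>r a b. a < p \<Longrightarrow> b < p \<Longrightarrow> fps_nth (lower_half p (V 0) $$ (a, b)) r = - alpha p N \<beta> R Q r $$ (a, b)"
proof -
  have \<beta>: "\<beta> k \<in> carrier_mat p (2 * p)" and \<beta>J: "\<beta> k * Jmat p * adj (\<beta> k) = 1\<^sub>m p" if "k \<le> N" for k
    using adm that by (auto simp: admissible_def)
  have an: "mat_analytic_near p R (- \<i>)" "mat_analytic_near p Q (- \<i>)"
    and det0: "det (W11 p N \<beta> (- \<i>) * R (- \<i>) + W12 p N \<beta> (- \<i>) * Q (- \<i>)) \<noteq> 0"
    using adm by (auto simp: admissible_def)
  have RQ: "R z \<in> carrier_mat p p" "Q z \<in> carrier_mat p p" for z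
    using an by (auto simp: mat_analytic_near_def)
  obtain Rf Qf where Rf: "mat_has_fps p p (\<lambda>z. R (cayley z)) Rf"
    and Qf: "mat_has_fps p p (\<lambda>z. Q (cayley z)) Qf"
    using cayley_has_fps[OF an(1)] cayley_has_fps[OF an(2)] by blast
  define s where "s z = (2 / (z + 1)) ^ Suc N" for z :: complex
  define sf where "sf = fps_expansion s 0"
  have sf: "s has_fps_expansion sf"
    unfolding sf_def s_def by (intro analytic_at_imp_has_fps_expansion_0 analytic_intros) auto
  define Z where "Z z = stack p (R (cayley z)) (Q (cayley z))" for z
  \<comment> \<open>The scalar powers of 2/(z + 1) are absorbed here; they cancel in the quotient
    that defines \<phi>.\<close>
  define Y where "Y z = s z \<cdot>\<^sub>m (Kmat p * Z z)" for z
  define Yf where "Yf = sf \<cdot>\<^sub>m (const_mat (Kmat p) * stack p Rf Qf)"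
  have Yf: "mat_has_fps (2 * p) p Y Yf"
    unfolding Y_def[abs_def] Yf_def Z_def
    by (intro mat_has_fps_smult sf mat_has_fps_mult[where m = "2 * p"] mat_has_fps_const
        stack_has_fps Rf Qf Kmat_carrier)
  define Ff where "Ff k = proj_factor (2 * p) (Pmat p (\<beta> k))" for k
  define X where "X z = chain (\<lambda>k. Fmat p \<beta> k z) (Y z) (Suc N) 0" for z
  define Xf where "Xf k = chain Ff Yf (Suc N - k) k" for k
  have Xf: "mat_has_fps (2 * p) p X (Xf 0)"
    unfolding X_def[abs_def] Xf_def diff_zero Ff_def
    by (rule chain_has_fps[OF Fmat_has_fps[OF \<beta>] Yf]) auto
  have Zd: "dim_row (Z z) = 2 * p" "dim_col (Z z) = p" for z
    using RQ[of "cayley z"] by (auto simp: Z_def)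
  have \<beta>d: "dim_col (\<beta> k) = 2 * p" if "k \<le> N" for k
    using \<beta>[OF that] by auto
  have calW_Z: "calW p N \<beta> (cayley z) * Z z = X z" if "z \<noteq> 1" "z \<noteq> - 1" for z
  proof -
    have "calW p N \<beta> (cayley z) * Z z =
        s z \<cdot>\<^sub>m chain (\<lambda>k. Fmat p \<beta> k z) (Kmat p * Z z) (Suc N) 0"
      unfolding calW_def s_def
      by (rule Kmat_adj_Wmat[OF \<beta> \<beta>J that]) (simp_all add: Zd)
    also have "\<dots> = X z"
      unfolding X_def Y_def
      by (rule chain_smult[where m = "2 * p", symmetric]) (auto simp: \<beta>d)
    finally show ?thesis .
  qed
  have halves: "W11 p N \<beta> (cayley z) * R (cayley z) + W12 p N \<beta> (cayley z) * Q (cayley z) = upper_half p (X z)"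
    "W21 p N \<beta> (cayley z) * R (cayley z) + W22 p N \<beta> (cayley z) * Q (cayley z) = lower_half p (X z)"
    if "z \<noteq> 1" "z \<noteq> - 1" for z
    unfolding calW_mult_stack[OF RQ calW_dims] calW_Z[OF that, unfolded Z_def] by simp_all
  define U where "U z = upper_half p (X z)" for z
  define Uf where "Uf = upper_half p (Xf 0)"
  have Uf: "mat_has_fps p p U Uf"
    unfolding U_def[abs_def] Uf_def by (rule half_has_fps(1)[OF Xf])
  have Ucar: "U z \<in> carrier_mat p p" and Ufcar: "Uf \<in> carrier_mat p p" for z
    using Uf by (auto simp: mat_has_fps_def)
  note detU = det_has_fps[OF Uf]
  have "det (U 0) \<noteq> 0"
    using halves(1)[of 0] det0 by (simp add: U_def)
  hence d0: "fps_nth (det Uf) 0 \<noteq> 0"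
    using has_fps_expansion_imp_0_eq_fps_nth_0[OF detU] by simp
  \<comment> \<open>The inverse of \<open>Uf\<close> over the ring of power series. The nonzero
    determinant at \<lambda> = -\<i> is the constant term that makes \<open>det Uf\<close>
    invertible.\<close>
  define mf where "mf = inverse (det Uf) \<cdot>\<^sub>m adj_mat Uf"
  have mf: "mat_has_fps p p (\<lambda>z. inverse (det (U z)) \<cdot>\<^sub>m adj_mat (U z)) mf"
    unfolding mf_def
    by (intro mat_has_fps_smult has_fps_expansion_inverse detU d0 adj_mat_has_fps Uf)
  have mfd: "dim_row mf = p" "dim_col mf = p"
    using mat_has_fpsD[OF mf] by auto
  have U_mf: "Uf * mf = 1\<^sub>m p"
  proof -
    have "det Uf * inverse (det Uf) = 1"
      using inverse_mult_eq_1[OF d0] by (simp add: mult.commute)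
    thus ?thesis
      unfolding mf_def using adj_mat(1)[OF Ufcar] Ufcar
      by (simp add: mat_mult_smult adj_mat(2)[OF Ufcar]) (auto intro!: eq_matI simp: mult.commute)
  qed
  have XfDim: "dim_row (Xf k) = 2 * p \<and> dim_col (Xf k) = p" if "k \<le> Suc N" for k
    using chain_dim[of k "Suc N - k" Ff "2 * p" Yf] mat_has_fpsD(1,2)[OF Yf] that \<beta>d
    by (simp add: Xf_def Ff_def)
  define L where "L = lower_half p (Xf 0) * mf"
  have L: "mat_has_fps p p (\<lambda>z. lower_half p (X z) * (inverse (det (U z)) \<cdot>\<^sub>m adj_mat (U z))) L"
    unfolding L_def by (rule mat_has_fps_mult[OF half_has_fps(2)[OF Xf] mf])
  have "continuous (at 0) (\<lambda>z. det (U z))"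
    by (rule has_fps_expansion_imp_continuous[OF detU])
  hence "((\<lambda>z. det (U z)) \<longlongrightarrow> det (U 0)) (nhds 0)"
    by (simp add: continuous_at tendsto_nhds_iff)
  hence "eventually (\<lambda>z. det (U z) \<noteq> 0) (nhds 0)"
    using \<open>det (U 0) \<noteq> 0\<close> by (rule tendsto_imp_eventually_ne)
  moreover have "eventually (\<lambda>z :: complex. z \<noteq> 1) (nhds 0)" "eventually (\<lambda>z :: complex. z \<noteq> - 1) (nhds 0)"
    by (rule t1_space_nhds; simp)+
  \<comment> \<open>The formula for \<phi> holds only where U is invertible and z avoids 1 and -1; a
    neighbourhood of 0 suffices for Taylor coefficients.\<close>
  ultimately have ev: "eventually (\<lambda>z. \<i> \<cdot>\<^sub>m phi p N \<beta> R Q (cayley z) =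
      \<i> \<cdot>\<^sub>m (\<i> \<cdot>\<^sub>m (lower_half p (X z) * (inverse (det (U z)) \<cdot>\<^sub>m adj_mat (U z))))) (nhds 0)"
  proof eventually_elim
    case (elim z)
    show ?case
      unfolding phi_def halves[OF elim(2,3)] U_def[symmetric]
      by (simp only: minv_eq_adj_mat[OF Ucar elim(1)])
  qed
  have alpha: "fps_nth (L $$ (a, b)) r = - alpha p N \<beta> R Q r $$ (a, b)" if ab: "a < p" "b < p" for a b r
  proof -
    have "(\<lambda>z. - ((lower_half p (X z) * (inverse (det (U z)) \<cdot>\<^sub>m adj_mat (U z))) $$ (a, b)))
        has_fps_expansion - (L $$ (a, b))"
      by (intro has_fps_expansion_minus mat_has_fpsD(5)[OF L] ab)
    moreover have "eventually (\<lambda>z. (\<i> \<cdot>\<^sub>m phi p N \<beta> R Q (cayley z)) $$ (a, b) =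
        - ((lower_half p (X z) * (inverse (det (U z)) \<cdot>\<^sub>m adj_mat (U z))) $$ (a, b))) (nhds 0)"
      using ev
    proof eventually_elim
      case (elim z)
      show ?case
        unfolding elim using ab mat_has_fpsD(3,4)[OF L, of z]
        by (simp add: mult_self_minus_one del: index_mult_mat(1))
    qed
    ultimately have "(\<lambda>z. (\<i> \<cdot>\<^sub>m phi p N \<beta> R Q (cayley z)) $$ (a, b)) has_fps_expansion - (L $$ (a, b))"
      by (subst has_fps_expansion_cong[OF _ refl])
    hence "alpha p N \<beta> R Q r $$ (a, b) = fps_nth (- (L $$ (a, b))) r"
      using ab fps_nth_fps_expansion[of _ "- (L $$ (a, b))" r] by (simp add: alpha_def taylor_coeff_def)
    thus ?thesis by simp
  qed
  show ?thesis
  proof (rule that[of "\<lambda>k. Xf k * mf"])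
    fix k assume "k \<le> Suc N"
    thus "Xf k * mf \<in> carrier_mat (2 * p) p"
      using XfDim[of k] mfd by (intro carrier_matI) auto
  next
    fix k assume k: "k \<le> N"
    have "Xf k = Ff k * Xf (Suc k)"
      using k by (simp add: Xf_def Suc_diff_le)
    thus "Xf k * mf = proj_factor (2 * p) (Pmat p (\<beta> k)) * (Xf (Suc k) * mf)"
      using k XfDim[of "Suc k"] mfd \<beta>d[OF k] by (simp add: Ff_def mat_mult_assoc)
  next
    show "upper_half p (Xf 0 * mf) = 1\<^sub>m p"
      using XfDim[of 0] mfd by (simp add: half_mult U_mf flip: Uf_def)
    show "fps_nth (lower_half p (Xf 0 * mf) $$ (a, b)) r = - alpha p N \<beta> R Q r $$ (a, b)"
      if "a < p" "b < p" for r a b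
      using XfDim[of 0] mfd alpha[OF that] by (simp add: half_mult flip: L_def)
  qed
qed

lemma Jmat_index:
  "i < 2 * p \<Longrightarrow> j < 2 * p \<Longrightarrow> Jmat p $$ (i, j) = (if i = p + j \<or> j = p + i then 1 else 0)"
  by (auto simp: Jmat_def)

lemma admissible_J_chain:
  assumes adm: "admissible p N \<beta> R Q"
  obtains V g0 E E' where "J_chain p N \<beta> V g0 E E' (alpha p N \<beta> R Q)"
proof -
  obtain V where V: "\<And>k. k \<le> Suc N \<Longrightarrow> V k \<in> carrier_mat (2 * p) p"
    and V_step: "\<And>k. k \<le> N \<Longrightarrow> V k = proj_factor (2 * p) (Pmat p (\<beta> k)) * V (Suc k)"
    and upper: "upper_half p (V 0) = 1\<^sub>m p"
    and lower: "\<And>r a b. a < p \<Longrightarrow> b < p \<Longrightarrow>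
        fps_nth (lower_half p (V 0) $$ (a, b)) r = - alpha p N \<beta> R Q r $$ (a, b)"
    using admissible_factorization[OF adm] by blast
  have V0d: "dim_row (V 0) = 2 * p" "dim_col (V 0) = p" using V[of 0] by auto
  have V0_up: "V 0 $$ (i, j) = (if i = j then 1 else 0)" if "i < p" "j < p" for i j
    using arg_cong[OF upper, of "\<lambda>A. A $$ (i, j)"] that V0d by (simp add: upper_half_def)
  \<comment> \<open>The row \<open>[G 1]\<close>, since the lower half of \<open>V 0\<close> is
    -G.\<close>
  define g0 where "g0 = mat p (2 * p) (\<lambda>(i, j). if j < p then - V 0 $$ (p + i, j) else if j = p + i then 1 else 0)"
  have g0d [simp]: "dim_row g0 = p" "dim_col g0 = 2 * p" by (simp_all add: g0_def)
  have g0_J: "(g0 * const_mat (Jmat p)) $$ (i, j) =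
      (if j < p then if i = j then 1 else 0 else - V 0 $$ (p + i, j - p))" if ij: "i < p" "j < 2 * p" for i j
  proof -
    have "(g0 * const_mat (Jmat p)) $$ (i, j) = (\<Sum>s<2 * p. g0 $$ (i, s) * fps_const (Jmat p $$ (s, j)))"
      using ij by (subst index_mult_sum) auto
    also have "\<dots> = (\<Sum>s<2 * p. if s = (if j < p then p + j else j - p) then g0 $$ (i, s) else 0)"
      using ij by (intro sum.cong refl) (auto simp: Jmat_index)
    also have "\<dots> = g0 $$ (i, if j < p then p + j else j - p)"
      using ij by (subst sum.delta) auto
    finally show ?thesis using ij by (auto simp: g0_def)
  qed
  \<comment> \<open>\<open>[1 0]\<close> picks the identity in the upper half of \<open>V 0\<close>;
    the column \<open>E'\<close> of 0 over 1 picks the identity in \<open>g0\<close>.\<close>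
  define E where "E = mat p (2 * p) (\<lambda>(i, j). if j = i then 1 else 0 :: complex)"
  define E' where "E' = mat (2 * p) p (\<lambda>(i, j). if i = p + j then 1 else 0 :: complex)"
  have [simp]: "dim_row E = p" "dim_col E = 2 * p" "dim_row E' = 2 * p" "dim_col E' = p"
    by (simp_all add: E_def E'_def)
  have "J_chain p N \<beta> V g0 E E' (alpha p N \<beta> R Q)"
  proof unfold_locales
    show "g0 * V 0 = 0\<^sub>m p p"
    proof (rule eq_matI)
      fix i j assume "i < dim_row (0\<^sub>m p p :: complex fps mat)" "j < dim_col (0\<^sub>m p p :: complex fps mat)"
      hence ij: "i < p" "j < p" by auto
      have "(g0 * V 0) $$ (i, j) = (\<Sum>s<2 * p. g0 $$ (i, s) * V 0 $$ (s, j))"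
        using ij V0d by (subst index_mult_sum) auto
      also have "\<dots> = (\<Sum>s<p. g0 $$ (i, s) * V 0 $$ (s, j)) + (\<Sum>s<p. g0 $$ (i, p + s) * V 0 $$ (p + s, j))"
        by (rule sum_two_halves)
      also have "(\<Sum>s<p. g0 $$ (i, s) * V 0 $$ (s, j)) = (\<Sum>s<p. if s = j then - V 0 $$ (p + i, s) else 0)"
        using ij by (intro sum.cong refl) (auto simp: g0_def V0_up)
      also have "(\<Sum>s<p. g0 $$ (i, p + s) * V 0 $$ (p + s, j)) = (\<Sum>s<p. if s = i then V 0 $$ (p + s, j) else 0)"
        using ij by (intro sum.cong refl) (auto simp: g0_def)
      finally show "(g0 * V 0) $$ (i, j) = 0\<^sub>m p p $$ (i, j)"
        using ij by simp
    qed (use V0d in auto)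
    show "E * at_0 (V 0) = 1\<^sub>m p"
    proof (rule eq_matI)
      fix i j assume "i < dim_row (1\<^sub>m p :: complex mat)" "j < dim_col (1\<^sub>m p :: complex mat)"
      hence ij: "i < p" "j < p" by auto
      have "(E * at_0 (V 0)) $$ (i, j) = (\<Sum>s<2 * p. E $$ (i, s) * fps_nth (V 0 $$ (s, j)) 0)"
        using ij V0d by (subst index_mult_sum) auto
      also have "\<dots> = (\<Sum>s<2 * p. if s = i then fps_nth (V 0 $$ (s, j)) 0 else 0)"
        using ij by (intro sum.cong refl) (auto simp: E_def)
      finally show "(E * at_0 (V 0)) $$ (i, j) = 1\<^sub>m p $$ (i, j)"
        using ij by (simp add: V0_up)
    qed (use V0d in auto)
    show "at_0 g0 * E' = 1\<^sub>m p"
    proof (rule eq_matI)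
      fix i j assume "i < dim_row (1\<^sub>m p :: complex mat)" "j < dim_col (1\<^sub>m p :: complex mat)"
      hence ij: "i < p" "j < p" by auto
      have "(at_0 g0 * E') $$ (i, j) = (\<Sum>s<2 * p. fps_nth (g0 $$ (i, s)) 0 * E' $$ (s, j))"
        using ij by (subst index_mult_sum) auto
      also have "\<dots> = (\<Sum>s<2 * p. if s = p + j then fps_nth (g0 $$ (i, s)) 0 else 0)"
        using ij by (intro sum.cong refl) (auto simp: E'_def)
      finally show "(at_0 g0 * E') $$ (i, j) = 1\<^sub>m p $$ (i, j)"
        using ij by (simp add: g0_def)
    qed auto
    show "(g0 * const_mat (Jmat p)) $$ (i, j) = (if i = j then 1 else 0)" if "i < p" "j < p" for i j
      using that by (subst g0_J) auto
    show "fps_nth ((g0 * const_mat (Jmat p)) $$ (i, p + j)) q = alpha p N \<beta> R Q q $$ (i, j)"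
      if "i < p" "j < p" "q \<le> N" for i j q
      using that lower[of i j q] V0d by (subst g0_J) (auto simp: lower_half_def)
    fix k assume "k \<le> N"
    hence \<beta>: "\<beta> k \<in> carrier_mat p (2 * p)" "\<beta> k * Jmat p * adj (\<beta> k) = 1\<^sub>m p"
      using adm by (auto simp: admissible_def)
    show "\<beta> k * Jmat p * adj (\<beta> k) = 1\<^sub>m p" by (rule \<beta>)
    show "\<beta> k * Jmat p \<in> carrier_mat p (2 * p)" "adj (\<beta> k) \<in> carrier_mat (2 * p) p"
      using \<beta>(1) by auto
    show "V k = proj_factor (2 * p) (adj (\<beta> k) * (\<beta> k * Jmat p)) * V (Suc k)"
      using V_step[OF \<open>k \<le> N\<close>] by (simp add: Pmat_def)
  qed (auto intro: V)
  thus ?thesis by (rule that)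
qed

section \<open>Uniqueness and the final statement\<close>

lemma PiMat_cong:
  assumes "\<And>r. r \<le> N \<Longrightarrow> \<alpha> r = \<alpha>' r"
  shows "PiMat p N \<alpha> = PiMat p N \<alpha>'"
proof -
  have "(\<Sum>l\<le>r div p. \<alpha> l $$ x) = (\<Sum>l\<le>r div p. \<alpha>' l $$ x)" if "r < Suc N * p" for r x
    using less_mult_imp_div_less[OF that] by (intro sum.cong refl) (auto simp: assms)
  hence "Phi2 p N \<alpha> = Phi2 p N \<alpha>'"
    unfolding Phi2_def by (intro cong_mat) auto
  thus ?thesis by (simp only: PiMat_def)
qed

lemma mat_sum_determines_summands:
  assumes M: "\<And>k. k \<le> N \<Longrightarrow> M k \<in> carrier_mat n n" and M': "\<And>k. k \<le> N \<Longrightarrow> M' k \<in> carrier_mat n n"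
    and eq: "\<And>k. k \<le> N \<Longrightarrow> mat_sum n M k = mat_sum n M' k" and k: "k \<le> N"
  shows "M k = M' k"
proof (rule eq_matI)
  fix i j assume "i < dim_row (M' k)" "j < dim_col (M' k)"
  hence ij: "i < n" "j < n" using M'[OF k] by auto
  have sums: "(\<Sum>l\<le>q. M l $$ (i, j)) = (\<Sum>l\<le>q. M' l $$ (i, j))" if "q \<le> N" for q
    using mat_sum_carrier(2)[of q M n i j] mat_sum_carrier(2)[of q M' n i j] M M' eq[OF that] ij that
    by auto
  show "M k $$ (i, j) = M' k $$ (i, j)"
  proof (cases k)
    case 0
    thus ?thesis using sums[of 0] by simp
  next
    case (Suc q)
    thus ?thesis using sums[of q] sums[of "Suc q"] k by simp
  qed
qed (use M[OF k] M'[OF k] in auto)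

theorem theorem5p3:
  fixes p N :: nat and \<beta> :: "nat \<Rightarrow> complex mat" and R Q :: "complex \<Rightarrow> complex mat"
  assumes "p \<ge> 1"
    and adm: "admissible p N \<beta> R Q"
  defines "\<alpha> \<equiv> alpha p N \<beta> R Q"
  defines "Pm \<equiv> PiMat p N \<alpha>"
  defines "A \<equiv> Amat p N"
  defines "n \<equiv> Suc N * p"
  shows "(\<forall>k\<le>N. adj (Cmat p \<beta> k) = Cmat p \<beta> k
                \<and> Cmat p \<beta> k * jmat p * Cmat p \<beta> k = jmat p
                \<and> pos_def (2 * p) (Cmat p \<beta> k))
       \<and> (\<forall>k<N. det (\<beta> k * Jmat p * adj (\<beta> (Suc k))) \<noteq> 0)
       \<and> (\<exists>!S. S \<in> carrier_mat n n \<and> A * S - S * adj A = \<i> \<cdot>\<^sub>m (Pm * Jmat p * adj Pm))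
       \<and> (\<forall>S. S \<in> carrier_mat n n \<and> A * S - S * adj A = \<i> \<cdot>\<^sub>m (Pm * Jmat p * adj Pm) \<longrightarrow>
              pos_def n S
              \<and> adj Pm * minv S * Pm = adj (Bmat p N \<beta>) * Bmat p N \<beta>
              \<and> adj (Bmat p N \<beta>) * Bmat p N \<beta>
                  = mat_sum (2 * p) (\<lambda>k. adj (\<beta> k) * \<beta> k) N)
       \<and> (\<forall>\<beta>' R' Q'. admissible p N \<beta>' R' Q' \<and>
              (\<forall>r\<le>N. alpha p N \<beta>' R' Q' r = \<alpha> r) \<longrightarrow>
              (\<forall>k\<le>N. Cmat p \<beta>' k = Cmat p \<beta> k))"
proof -
  have car: "b k \<in> carrier_mat p (2 * p)" "b k * Jmat p * adj (b k) = 1\<^sub>m p"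
    if "admissible p N b R' Q'" "k \<le> N" for b R' Q' k
    using that by (auto simp: admissible_def)
  obtain V g0 E E' where "J_chain p N \<beta> V g0 E E' \<alpha>"
    unfolding \<alpha>_def using admissible_J_chain[OF adm] by blast
  then interpret J_chain p N \<beta> V g0 E E' \<alpha> .
  have unique: "Cmat p \<beta>' k = Cmat p \<beta> k"
    if adm': "admissible p N \<beta>' R' Q'" and eq: "\<forall>r\<le>N. alpha p N \<beta>' R' Q' r = \<alpha> r" and k: "k \<le> N"
    for \<beta>' R' Q' k
  proof -
    obtain V' g0' L L' where chain': "J_chain p N \<beta>' V' g0' L L' (alpha p N \<beta>' R' Q')"
      using admissible_J_chain[OF adm'] by blast
    have "mat_sum (2 * p) (\<lambda>k. adj (\<beta>' k) * \<beta>' k) M = mat_sum (2 * p) (\<lambda>k. adj (\<beta> k) * \<beta> k) M"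
      if M: "M \<le> N" for M
    proof -
      interpret M: J_chain p M \<beta> V g0 E E' \<alpha> by (rule truncate[OF M])
      interpret M': J_chain p M \<beta>' V' g0' L L' "alpha p N \<beta>' R' Q'"
        by (rule J_chain.truncate[OF chain' M])
      have Pi: "PiMat p M (alpha p N \<beta>' R' Q') = PiMat p M \<alpha>"
        by (rule PiMat_cong) (use eq M in auto)
      \<comment> \<open>With the same \<Pi>, one \<open>S\<close> solves the equation of both
        truncated chains, so each Gram matrix is the same expression in \<Pi> and
        \<open>S\<close>.\<close>
      obtain S where S: "S \<in> carrier_mat (Suc M * p) (Suc M * p)"
        "Amat p M * S - S * adj (Amat p M) = \<i> \<cdot>\<^sub>m (PiMat p M \<alpha> * Jmat p * adj (PiMat p M \<alpha>))"
        using M.unique_solution by blast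
      have "adj (Bmat p M \<beta>') * Bmat p M \<beta>' = adj (Bmat p M \<beta>) * Bmat p M \<beta>"
        using M.solution_properties(2)[OF S] M'.solution_properties(2)[unfolded Pi, OF S] by (simp only:)
      thus ?thesis
        by (simp only: Bmat_gram[OF M.\<beta>] Bmat_gram[OF M'.\<beta>])
    qed
    hence "adj (\<beta>' k) * \<beta>' k = adj (\<beta> k) * \<beta> k"
      using car(1)[OF adm] car(1)[OF adm'] k
      by (intro mat_sum_determines_summands[where n = "2 * p" and N = N
            and M = "\<lambda>k. adj (\<beta>' k) * \<beta>' k" and M' = "\<lambda>k. adj (\<beta> k) * \<beta> k"] mult_carrier_mat[of _ _ p]) auto
    \<comment> \<open>\<open>\<beta> k\<close> itself is not determined, as a unitary left factor
      leaves \<open>adj (\<beta> k) * \<beta> k\<close> unchanged; \<open>Cmat\<close> depends on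
      this product only.\<close>
    moreover have "Cmat p b k = 2 \<cdot>\<^sub>m (adj (Kmat p) * (adj (b k) * b k) * Kmat p) - jmat p"
      if "b k \<in> carrier_mat p (2 * p)" for b
      using carrier_matD[OF that] by (simp add: Cmat_def mat_mult_assoc)
    ultimately show ?thesis
      using car(1)[OF adm k] car(1)[OF adm' k] by simp
  qed
  show ?thesis
    unfolding n_def A_def Pm_def
  proof (intro conjI allI impI)
    fix k assume "k \<le> N"
    note Cmat_properties[of \<beta> k p, OF car[OF adm this]]
    thus "adj (Cmat p \<beta> k) = Cmat p \<beta> k" "Cmat p \<beta> k * jmat p * Cmat p \<beta> k = jmat p"
      "pos_def (2 * p) (Cmat p \<beta> k)" by simp_all
  next
    show "det (\<beta> k * Jmat p * adj (\<beta> (Suc k))) \<noteq> 0" if "k < N" for k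
      by (rule det_step[OF that])
  next
    show "\<exists>!S. S \<in> carrier_mat (Suc N * p) (Suc N * p) \<and> Amat p N * S - S * adj (Amat p N) =
        \<i> \<cdot>\<^sub>m (PiMat p N \<alpha> * Jmat p * adj (PiMat p N \<alpha>))"
      by (rule unique_solution)
  next
    fix S assume "S \<in> carrier_mat (Suc N * p) (Suc N * p) \<and> Amat p N * S - S * adj (Amat p N) =
        \<i> \<cdot>\<^sub>m (PiMat p N \<alpha> * Jmat p * adj (PiMat p N \<alpha>))"
    thus "pos_def (Suc N * p) S"
      "adj (PiMat p N \<alpha>) * minv S * PiMat p N \<alpha> = adj (Bmat p N \<beta>) * Bmat p N \<beta>"
      using solution_properties by blast+
  next
    show "adj (Bmat p N \<beta>) * Bmat p N \<beta> = mat_sum (2 * p) (\<lambda>k. adj (\<beta> k) * \<beta> k) N"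
      by (rule Bmat_gram[OF \<beta>])
  next
    show "Cmat p \<beta>' k = Cmat p \<beta> k"
      if "admissible p N \<beta>' R' Q' \<and> (\<forall>r\<le>N. alpha p N \<beta>' R' Q' r = \<alpha> r)" "k \<le> N" for \<beta>' R' Q' k
      using unique that by blast
  qed
qed

end
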